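(* Let $d\ge 2$ be an integer, let $c$ be an indeterminate and let $f_c(z)=z^d+c$. Then for all positive integers $m$, the multiplier polynomial $\delta_m(x)$ of $f_c$ lies in the ring $\mathbb{Z}[d^dc^{d-1},x]$, and $(-1)^{d_m/m}\delta_m(x)$ is monic in $d^dc^{d-1}$ (that is, viewed as a polynomial in $t=d^dc^{d-1}$ with coefficients in $\mathbb{Z}[x]$ its leading coefficient is $1$), where $d_m=\sum_{k\mid m}d^k\mu(m/k)$ and $\mu$ is the Möbius function.
   Context: Regard $f=f_c$ as a polynomial in $z$ over $\mathbb{Z}[c]$; $f^{\circ k}$ denotes the $k$-th iterate. The $m$-th dynatomic polynomial is $\Phi_m^*(z)=\prod_{k\mid m}(f^{\circ k}(z)-z)^{\mu(m/k)}$, a polynomial in $z$ of degree $d_m$. For a root $\alpha\in\overline{\mathbb{Q}(c)}$ of $\Phi_m^*$, its multiplier is $\omega_m(\alpha)=(f^{\circ m})'(\alpha)$. The $m$-th multiplier polynomial $\delta_m(x)\in\mathbb{Z}[c][x]$ is the monic polynomial in $x$ satisfying $\delta_m(x)^m=\prod_{\Phi_m^*(\alpha)=0}(x-\omega_m(\alpha))$ (roots counted with multiplicity). *)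

theory Defs
  imports
    "HOL-Computational_Algebra.Computational_Algebra"
    "HOL-Algebra.Algebraic_Closure_Type"
begin

text \<open>
  The ring $\mathbb{Z}[c]$ is \<^typ>\<open>int poly\<close>. A polynomial over $\mathbb{Z}[c]$ in a further
  variable ($z$ for the iterates and the dynatomic polynomials, $x$ for the multiplier polynomials)
  is an \<^typ>\<open>int poly poly\<close>, the further variable being the outer one.
  The field $\overline{\mathbb{Q}(c)}$ is \<^typ>\<open>int poly fract alg_closure\<close>.
\<close>

definition moebius_mu :: "nat \<Rightarrow> int" where
  "moebius_mu n = (if squarefree n then (-1) ^ card (prime_factors n) else 0)"

definition unicrit :: "nat \<Rightarrow> int poly poly" where
  "unicrit d = [:0, 1:] ^ d + [:[:0, 1:]:]"

definition iterate :: "nat \<Rightarrow> nat \<Rightarrow> int poly poly" where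
  "iterate d k = (pcompose (unicrit d) ^^ k) [:0, 1:]"

text \<open>
  The product defining $\Phi_m^*$ contains negative exponents, so it is formed in the field of
  fractions of $\mathbb{Z}[c][z]$; $\Phi_m^*$ is the polynomial equal to it.
\<close>

definition dynatomic :: "nat \<Rightarrow> nat \<Rightarrow> int poly poly" where
  "dynatomic d m = (THE \<Phi>. to_fract \<Phi> =
     (\<Prod>k | k dvd m. to_fract (iterate d k - [:0, 1:]) powi moebius_mu (m div k)))"

definition dyn_degree :: "nat \<Rightarrow> nat \<Rightarrow> int" where
  "dyn_degree d m = (\<Sum>k | k dvd m. int d ^ k * moebius_mu (m div k))"

definition base_emb :: "int poly \<Rightarrow> int poly fract alg_closure" where
  "base_emb p = to_ac (to_fract p)"

definition multiplier :: "nat \<Rightarrow> nat \<Rightarrow> int poly fract alg_closure \<Rightarrow> int poly fract alg_closure" where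
  "multiplier d m \<alpha> = poly (pderiv (map_poly base_emb (iterate d m))) \<alpha>"

definition multiplier_poly :: "nat \<Rightarrow> nat \<Rightarrow> int poly poly" where
  "multiplier_poly d m = (THE \<delta>. lead_coeff \<delta> = 1 \<and>
     map_poly base_emb \<delta> ^ m =
       (\<Prod>\<alpha>\<in>#proots (map_poly base_emb (dynatomic d m)). [:- multiplier d m \<alpha>, 1:]))"

text \<open>
  A polynomial $G \in \mathbb{Z}[x][t]$ (outer variable $t$, coefficients in $\mathbb{Z}[x]$) is
  evaluated at $t = d^d c^{d-1}$, which gives an element of $\mathbb{Z}[c][x]$. The inner
  \<^const>\<open>map_poly\<close> is the inclusion of $\mathbb{Z}[x]$ into $\mathbb{Z}[c][x]$.
\<close>

definition eval_t :: "nat \<Rightarrow> int poly poly \<Rightarrow> int poly poly" where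
  "eval_t d G =
     poly (map_poly (map_poly (\<lambda>a. [:a:])) G) [:Polynomial.monom (int d ^ d) (d - 1):]"

end

theory Submission
  imports Defs
begin

text \<open>
  Work in an algebraically closed field containing the transcendental element $c$, and put
  $t = d^d c^{d-1}$. The multiplier of a cycle is $\prod d z^{d-1}$ over its points, and $\delta_m$ is
  the product of the factors $x - \omega$ over all cycles of exact length $m$. The theorem says that
  its coefficients lie in $\mathbb{Z}[t]$ and which of them has the highest degree in $t$.

  All integrality statements come from one principle (\<open>integrally_closed\<close>): if $s$ is
  transcendental and $U$ is a finite set in which every $u^d$ is a $\mathbb{Z}[s]$-linear combination of
  $1$ and elements of $U$, then $\mathbb{Z}[s][U] \cap \mathbb{Q}(s) = \mathbb{Z}[s]$. The equation
  $f(z) = z^d + c$ has exactly this shape, and it keeps the shape under changes of the coordinate.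
  Rationality of coefficients comes from power sums through Newton's identities
  (\<open>prod_linear_poly_over\<close>).

  The coordinate $z$ over $\mathbb{Z}[c]$ shows that $1$ is never a multiplier, as $1/d$ would be
  integral. So $f^{\circ m}(z) - z$ has simple roots, it is the product over $k \mid m$ of the
  polynomials whose roots are the points of exact period $k$, these polynomials have
  coefficients in $\mathbb{Z}[c]$, and Moebius inversion identifies them with the dynatomic polynomials
  (\<open>fixed_poly_eq_prod\<close>, \<open>period_poly_integral\<close>, \<open>dynatomic_eq_Phi\<close>).

  The coordinate $z/c$, in which $f$ is $y \mapsto c^{d-1} y^d + 1$, shows that the coefficients of
  $\delta_m$ are in $\mathbb{Q}(t)$. The coordinate $d^{1/(d-1)} z$, in which every factor of the
  multiplier is a pure power, shows that they are integral over $\mathbb{Z}[t]$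
  (\<open>mult_poly_integral\<close>). The coordinate $c^{-1/d} z$ over $\mathbb{Z}[1/t]$ shows that a
  multiplier grows at most like $t^{m/d}$, so that the coefficient of $x^n$ has degree at most
  $(N - n) m / d$ for $N = d_m / m$ cycles (\<open>degree_coeff_mult_poly\<close>). For $n = 0$ the bound
  is attained: the product of all multipliers is $d^{d_m} \Phi_m(0)^{d-1}$, and $\Phi_m(0)$ is monic in
  $c$ because the product of the $\Phi_k(0)$ over $k \mid m$ is the monic polynomial $f^{\circ m}(0)$
  (\<open>constant_coeff_mult_poly\<close>). Hence the leading term of $\delta_m$ in $t$ is
  $(-1)^N t^{d_m / d}$.
\<close>

section \<open>Evaluation of integer polynomials\<close>

definition ev :: "'k::comm_ring_1 \<Rightarrow> int poly \<Rightarrow> 'k" where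
  "ev s p = poly (map_poly of_int p) s"

lemma ev_pCons [simp]: "ev s (pCons a p) = of_int a + s * ev s p"
  by (simp add: ev_def map_poly_pCons)

lemma ev_0 [simp]: "ev s 0 = 0"
  by (simp add: ev_def)

lemma ev_1 [simp]: "ev s 1 = 1"
  unfolding one_pCons by simp

lemma ev_add [simp]: "ev s (p + q) = ev s p + ev s q"
proof (induction p arbitrary: q)
  case (pCons a p)
  obtain b r where q: "q = pCons b r" by (cases q)
  show ?case
    by (simp add: q pCons.IH algebra_simps)
qed simp

lemma ev_smult [simp]: "ev s (smult a p) = of_int a * ev s p"
  by (induction p) (simp_all add: algebra_simps)

lemma ev_uminus [simp]: "ev s (- p) = - ev s p"
  by (induction p) (simp_all add: algebra_simps)

lemma ev_diff [simp]: "ev s (p - q) = ev s p - ev s q"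
  using ev_add[of s p "- q"] by simp

lemma ev_mult [simp]: "ev s (p * q) = ev s p * ev s q"
  by (induction p) (simp_all add: algebra_simps)

lemma ev_power [simp]: "ev s (p ^ n) = ev s p ^ n"
  by (induction n) simp_all

lemma ev_monom [simp]: "ev s (Polynomial.monom a n) = of_int a * s ^ n"
  by (induction n) (simp_all add: monom_0 monom_Suc algebra_simps)

lemma ev_pcompose [simp]: "ev s (pcompose p q) = ev (ev s q) p"
  by (induction p) (simp_all add: pcompose_pCons)

text \<open>
  Transcendence over the prime ring says that evaluation at $s$ is injective, so that its range
  $\mathbb{Z}[s]$ is a copy of the factorial ring \<^typ>\<open>int poly\<close> inside the field. It forces
  characteristic $0$.
\<close>

definition transcendental :: "'k::field \<Rightarrow> bool" where
  "transcendental s \<longleftrightarrow> (\<forall>p. p \<noteq> 0 \<longrightarrow> ev s p \<noteq> 0)"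

lemma transcendental_ev_eq_iff:
  assumes "transcendental s"
  shows "ev s p = ev s q \<longleftrightarrow> p = q"
  using assms ev_diff[of s p q] by (metis eq_iff_diff_eq_0 transcendental_def)

lemma transcendental_of_int_eq_0_iff:
  assumes "transcendental (s :: 'k::field)"
  shows "(of_int a :: 'k) = 0 \<longleftrightarrow> a = 0"
  using transcendental_ev_eq_iff[OF assms, of "[:a:]" 0] by simp

lemma transcendental_nonzero: "transcendental s \<Longrightarrow> s \<noteq> 0"
  using transcendental_ev_eq_iff[of s "[:0, 1:]" 0] by auto

text \<open>
  If $q(s)$ were a root of $p$, then $s$ would be a root of $p \circ q$, which is nonzero because $q$
  is not constant.
\<close>

lemma transcendental_ev:
  assumes "transcendental s" "degree q > 0"
  shows "transcendental (ev s q)"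
  unfolding transcendental_def
proof safe
  fix p :: "int poly" assume p: "p \<noteq> 0" "ev (ev s q) p = 0"
  then have "ev s (pcompose p q) = ev s 0" by simp
  then have "pcompose p q = 0"
    using transcendental_ev_eq_iff[OF assms(1)] by blast
  then show False using pcompose_eq_0 p assms(2) by blast
qed

lemma ev_reflect_poly:
  assumes "transcendental (s :: 'k::field)"
  shows "ev s (reflect_poly p) = s ^ degree p * ev (inverse s) p"
proof -
  have map: "map_poly of_int (reflect_poly p) = reflect_poly (map_poly of_int p :: 'k poly)"
    by (rule poly_eqI)
       (auto simp: coeff_map_poly coeff_reflect_poly degree_map_poly
          transcendental_of_int_eq_0_iff[OF assms])
  show ?thesis
    unfolding ev_def map using transcendental_nonzero[OF assms]
    by (simp add: poly_reflect_poly_nz degree_map_poly transcendental_of_int_eq_0_iff[OF assms])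
qed

lemma transcendental_inverse:
  assumes "transcendental s"
  shows "transcendental (inverse s)"
  unfolding transcendental_def
proof safe
  fix p :: "int poly" assume p: "p \<noteq> 0" "ev (inverse s) p = 0"
  then have "ev s (reflect_poly p) = ev s 0"
    by (simp add: ev_reflect_poly[OF assms])
  then show False
    using transcendental_ev_eq_iff[OF assms] p(1) reflect_poly_eq_0_iff by blast
qed

section \<open>Integral closedness of polynomial rings\<close>

text \<open>
  The $\mathbb{Z}[s]$-submodule generated by a set, a polynomial acting through its value at $s$.
\<close>

definition ev_span :: "'k::comm_ring_1 \<Rightarrow> 'k set \<Rightarrow> 'k set" where
  "ev_span s = Modules.module.span (\<lambda>p x. ev s p * x)"

interpretation ev_module: Modules.module "\<lambda>p x. ev s p * x"
  rewrites "Modules.module.span (\<lambda>p x. ev s p * x) = ev_span s"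
  for s :: "'k::comm_ring_1"
  by (unfold_locales; simp add: algebra_simps) (simp add: ev_span_def)

text \<open>
  The ring $\mathbb{Z}[s][U]$, presented as the $\mathbb{Z}[s]$-module spanned by the monomials in
  elements of $U$. This is the form in which it can be compared with modules of finite type.
\<close>

definition adjoin :: "'k::comm_ring_1 \<Rightarrow> 'k set \<Rightarrow> 'k set" where
  "adjoin s U = ev_span s {prod_mset M | M. set_mset M \<subseteq> U}"

lemma adjoin_base: "set_mset M \<subseteq> U \<Longrightarrow> prod_mset M \<in> adjoin s U"
  unfolding adjoin_def by (rule ev_module.span_base) blast

lemma adjoin_generator: "u \<in> U \<Longrightarrow> u \<in> adjoin s U"
  using adjoin_base[of "{#u#}" U s] by simp

lemma ev_span_mult:
  assumes "x \<in> ev_span s S" "y \<in> ev_span s T"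
    and "\<And>a b. a \<in> S \<Longrightarrow> b \<in> T \<Longrightarrow> a * b \<in> ev_span s V"
  shows "x * y \<in> ev_span s V"
proof -
  have left: "a * y \<in> ev_span s V" if "a \<in> S" for a
    using assms(2)
  proof (induction rule: ev_module.span_induct_alt)
    case (step e b v)
    then have "ev s e * (a * b) + a * v \<in> ev_span s V"
      using assms(3) that by (intro ev_module.span_add ev_module.span_scale) auto
    then show ?case by (simp add: algebra_simps)
  qed (simp add: ev_module.span_zero)
  show ?thesis using assms(1)
  proof (induction rule: ev_module.span_induct_alt)
    case (step e a v)
    then have "ev s e * (a * y) + v * y \<in> ev_span s V"
      using left by (intro ev_module.span_add ev_module.span_scale) auto
    then show ?case by (simp add: algebra_simps)
  qed (simp add: ev_module.span_zero)
qed

text \<open>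
  Subrings are subsets of a type of class \<^class>\<open>comm_ring_1\<close>. The instances that
  matter are rings $\mathbb{Z}[s][U]$ and fields $\mathbb{Q}(s)$ inside one algebraically closed field,
  and the question about a polynomial over that field is always where its coefficients lie.
\<close>

locale type_subring =
  fixes R :: "'k::comm_ring_1 set"
  assumes one_closed [simp, intro]: "1 \<in> R"
    and add_closed [simp, intro]: "x \<in> R \<Longrightarrow> y \<in> R \<Longrightarrow> x + y \<in> R"
    and uminus_closed [simp, intro]: "x \<in> R \<Longrightarrow> - x \<in> R"
    and mult_closed [simp, intro]: "x \<in> R \<Longrightarrow> y \<in> R \<Longrightarrow> x * y \<in> R"
begin

lemma zero_closed [simp, intro]: "0 \<in> R"
  using add_closed[OF one_closed uminus_closed[OF one_closed]] by simp

lemma diff_closed [simp, intro]: "x \<in> R \<Longrightarrow> y \<in> R \<Longrightarrow> x - y \<in> R"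
  using add_closed[of x "- y"] by simp

lemma power_closed [simp, intro]: "x \<in> R \<Longrightarrow> x ^ n \<in> R"
  by (induction n) auto

lemma sum_closed: "(\<And>i. i \<in> A \<Longrightarrow> f i \<in> R) \<Longrightarrow> sum f A \<in> R"
  by (induction A rule: infinite_finite_induct) auto

lemma prod_closed: "(\<And>i. i \<in> A \<Longrightarrow> f i \<in> R) \<Longrightarrow> prod f A \<in> R"
  by (induction A rule: infinite_finite_induct) auto

lemma of_nat_closed [simp, intro]: "of_nat n \<in> R"
  by (induction n) auto

lemma of_int_closed [simp, intro]: "of_int n \<in> R"
  by (cases n) (auto simp del: of_nat_Suc)

lemma ev_closed: "s \<in> R \<Longrightarrow> ev s p \<in> R"
  by (induction p) auto

definition poly_over :: "'k poly set" where
  "poly_over = {p. \<forall>n. coeff p n \<in> R}"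

lemma poly_overI: "(\<And>n. coeff p n \<in> R) \<Longrightarrow> p \<in> poly_over"
  by (simp add: poly_over_def)

lemma coeff_poly_over: "p \<in> poly_over \<Longrightarrow> coeff p n \<in> R"
  by (simp add: poly_over_def)

lemma pCons_poly_over: "a \<in> R \<Longrightarrow> p \<in> poly_over \<Longrightarrow> pCons a p \<in> poly_over"
  by (auto simp: poly_over_def coeff_pCons split: nat.split)

lemma smult_poly_over: "a \<in> R \<Longrightarrow> p \<in> poly_over \<Longrightarrow> smult a p \<in> poly_over"
  by (rule poly_overI) (metis coeff_smult coeff_poly_over mult_closed)

lemma zero_poly_over: "0 \<in> poly_over"
  by (auto simp: poly_over_def)

lemma subring_poly_over: "type_subring poly_over"
proof
  fix p q assume "p \<in> poly_over" "q \<in> poly_over"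
  then show "p * q \<in> poly_over"
    unfolding poly_over_def by (auto simp: coeff_mult intro!: sum_closed)
qed (auto simp: poly_over_def coeff_1)

lemmas add_poly_over = type_subring.add_closed[OF subring_poly_over]
lemmas diff_poly_over = type_subring.diff_closed[OF subring_poly_over]
lemmas power_poly_over = type_subring.power_closed[OF subring_poly_over]
lemmas prod_poly_over = type_subring.prod_closed[OF subring_poly_over]

end

interpretation adjoin: type_subring "adjoin s U" for s :: "'k::comm_ring_1" and U
proof
  show "1 \<in> adjoin s U"
    using adjoin_base[of "{#}" U s] by simp
  show "x * y \<in> adjoin s U" if "x \<in> adjoin s U" "y \<in> adjoin s U" for x y
    using that unfolding adjoin_def
  proof (rule ev_span_mult)
    fix a b assume "a \<in> {prod_mset M | M. set_mset M \<subseteq> U}" "b \<in> {prod_mset M | M. set_mset M \<subseteq> U}"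
    then obtain M N where "a = prod_mset M" "b = prod_mset N" "set_mset (M + N) \<subseteq> U"
      by auto
    then show "a * b \<in> ev_span s {prod_mset M | M. set_mset M \<subseteq> U}"
      using adjoin_base[of "M + N" U s] by (simp add: adjoin_def)
  qed
qed (auto simp: adjoin_def intro: ev_module.span_add ev_module.span_neg)

lemma adjoin_ev: "ev s p \<in> adjoin s U"
  using ev_module.span_scale[of 1 s _ p] adjoin.one_closed[of s U] by (simp add: adjoin_def)

text \<open>
  A monomial of degree greater than $d \cdot |U|$ contains some $u$ at least $d$ times. Replacing
  $u^d$ by a linear combination of $1$ and elements of $U$ turns it into a combination of monomials of
  smaller degree, since $d \ge 2$. Only the monomials of bounded degree remain in the end.
\<close>

lemma monomial_in_bounded_span:
  fixes s :: "'k::comm_ring_1"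
  assumes U: "finite U" and d: "d \<ge> 2"
    and pow: "\<And>u. u \<in> U \<Longrightarrow> u ^ d \<in> ev_span s (insert 1 U)"
    and M: "set_mset M \<subseteq> U"
  shows "prod_mset M \<in> ev_span s {prod_mset N | N. set_mset N \<subseteq> U \<and> size N \<le> d * card U}"
    (is "_ \<in> ?V")
  using M
proof (induction "size M" arbitrary: M rule: less_induct)
  case less
  show ?case
  proof (cases "size M \<le> d * card U")
    case True
    then show ?thesis using less.prems by (intro ev_module.span_base) blast
  next
    case False
    obtain u where u: "u \<in> U" "d \<le> count M u"
    proof (rule ccontr)
      assume "\<not> thesis"
      with that have "count M u \<le> d" if "u \<in> U" for u
        using that by (meson nat_le_linear)
      then have "(\<Sum>u\<in>U. count M u) \<le> d * card U"
        using sum_bounded_above[of U "count M" d] by (simp add: mult.commute)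
      moreover have "size M = (\<Sum>u\<in>U. count M u)"
        unfolding size_multiset_overloaded_eq using less.prems U
        by (intro sum.mono_neutral_left) (auto simp: count_eq_zero_iff)
      ultimately show False using False by simp
    qed
    define M' where "M' = M - replicate_mset d u"
    have MM': "M = replicate_mset d u + M'"
      using u unfolding M'_def by (simp add: count_le_replicate_mset_subset_eq)
    have step: "v * prod_mset M' \<in> ?V" if "v \<in> insert 1 U" for v
    proof -
      obtain N where N: "prod_mset N = v" "size N \<le> 1" "set_mset N \<subseteq> U"
        using \<open>v \<in> insert 1 U\<close>
        by (cases "v = 1") (auto intro: that[of "{#}"] that[of "{#v#}"])
      have "prod_mset (N + M') \<in> ?V"
        using N d less.prems MM' by (intro less.hyps) auto
      then show ?thesis using N by simp
    qed
    have "prod_mset M = u ^ d * prod_mset M'"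
      by (simp add: MM')
    also have "\<dots> \<in> ?V"
      by (rule ev_span_mult[OF pow[OF u(1)], of _ "{prod_mset M'}"])
         (auto intro: step ev_module.span_base)
    finally show ?thesis .
  qed
qed

text \<open>
  The hypothesis makes all elements of $U$ integral over $\mathbb{Z}[s]$ at once, each $u^d$ being a
  linear expression in the elements of $U$. This is the shape of the equations satisfied by the points of a
  cycle of $z^d + c$ in every coordinate that is used below.
\<close>

lemma adjoin_finite_module:
  fixes s :: "'k::comm_ring_1"
  assumes U: "finite U" and d: "d \<ge> 2"
    and pow: "\<And>u. u \<in> U \<Longrightarrow> u ^ d \<in> ev_span s (insert 1 U)"
  obtains W where "finite W" "adjoin s U \<subseteq> ev_span s W"
proof
  \<comment> \<open>Multisets of bounded size correspond to lists of bounded length, of which there are finitely many.\<close>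
  let ?W = "{prod_mset N | N. set_mset N \<subseteq> U \<and> size N \<le> d * card U}"
  have "?W \<subseteq> (\<lambda>xs. prod_mset (mset xs)) ` {xs. set xs \<subseteq> U \<and> length xs \<le> d * card U}"
  proof
    fix x assume "x \<in> ?W"
    then obtain N where "x = prod_mset N" "set_mset N \<subseteq> U" "size N \<le> d * card U"
      by blast
    moreover obtain xs where "mset xs = N"
      using ex_mset by blast
    ultimately show "x \<in> (\<lambda>xs. prod_mset (mset xs)) ` {xs. set xs \<subseteq> U \<and> length xs \<le> d * card U}"
      by force
  qed
  then show "finite ?W"
    using finite_lists_length_le[OF U] finite_surj by blast
  show "adjoin s U \<subseteq> ev_span s ?W"
    unfolding adjoin_def
    by (rule ev_module.span_minimal)
       (use monomial_in_bounded_span[OF U d pow] in auto)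
qed

text \<open>
  The subfield $\mathbb{Q}(s)$, for transcendental $s$.
\<close>

definition fractions :: "'k::field \<Rightarrow> 'k set" where
  "fractions s = {x. \<exists>p q. q \<noteq> 0 \<and> ev s q * x = ev s p}"

text \<open>
  Induction on the generators, starting from the module $\mathbb{Z}[s] \cdot 1$. A new generator $w$
  either has a nonzero multiple $e w$ in the old module, and then multiplication by $e$ brings the
  new module into the old one, or it is linearly independent of the old module, and then no element
  of $\mathbb{Q}(s)$ involves it, because $1$ belongs to the old module.
\<close>

lemma common_denominator:
  fixes s :: "'k::field"
  assumes s: "transcendental s" and W: "finite W"
  shows "\<exists>D. D \<noteq> 0 \<and> (\<forall>x \<in> ev_span s (insert 1 W) \<inter> fractions s. ev s D * x \<in> range (ev s))"
  using W
proof (induction W rule: finite_induct)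
  case empty
  have "ev s 1 * x \<in> range (ev s)" if "x \<in> ev_span s {1}" for x
    using that by (auto simp: ev_module.span_singleton)
  then show ?case by (intro exI[of _ 1]) auto
next
  case (insert w W)
  let ?V = "ev_span s (insert 1 W)"
  obtain D where D: "D \<noteq> 0" "\<And>x. x \<in> ?V \<Longrightarrow> x \<in> fractions s \<Longrightarrow> ev s D * x \<in> range (ev s)"
    using insert.IH by blast
  have split: "\<exists>a. x - ev s a * w \<in> ?V" if "x \<in> ev_span s (insert 1 (insert w W))" for x
    using that by (simp add: insert_commute[of 1] ev_module.span_breakdown_eq)
  show ?case
  proof (cases "\<exists>e. e \<noteq> 0 \<and> ev s e * w \<in> ?V")
    case True
    then obtain e where e: "e \<noteq> 0" "ev s e * w \<in> ?V" by blast
    have "ev s (D * e) * x \<in> range (ev s)"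
      if x: "x \<in> ev_span s (insert 1 (insert w W))" "x \<in> fractions s" for x
    proof -
      obtain a where a: "x - ev s a * w \<in> ?V" using split x by blast
      have "ev s a * (ev s e * w) + ev s e * (x - ev s a * w) \<in> ?V"
        by (intro ev_module.span_add ev_module.span_scale a e)
      then have "ev s e * x \<in> ?V" by (simp add: algebra_simps)
      moreover have "ev s e * x \<in> fractions s"
      proof -
        obtain p q where "q \<noteq> 0" "ev s q * x = ev s p" using x(2) by (auto simp: fractions_def)
        then have "q \<noteq> 0 \<and> ev s q * (ev s e * x) = ev s (e * p)"
          by (simp add: mult.left_commute)
        then show ?thesis unfolding fractions_def by blast
      qed
      ultimately show ?thesis using D(2)[of "ev s e * x"] unfolding ev_mult mult.assoc by blast
    qed
    then show ?thesis using D(1) e(1) by (intro exI[of _ "D * e"]) auto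
  next
    case False
    have "x \<in> ?V" if x: "x \<in> ev_span s (insert 1 (insert w W))" "x \<in> fractions s" for x
    proof -
      obtain a where a: "x - ev s a * w \<in> ?V" using split x by blast
      obtain p q where pq: "q \<noteq> 0" "ev s q * x = ev s p" using x(2) by (auto simp: fractions_def)
      have "ev s p * 1 - ev s q * (x - ev s a * w) \<in> ?V"
        by (intro ev_module.span_diff ev_module.span_scale a ev_module.span_base) auto
      then have "ev s (q * a) * w \<in> ?V" using pq(2) by (simp add: algebra_simps)
      then have "q * a = 0" using False by blast
      then show ?thesis using a pq(1) by simp
    qed
    then show ?thesis using D by blast
  qed
qed

text \<open>
  All powers of $x$ lie in the finitely generated module $\mathbb{Z}[s][U]$ and in $\mathbb{Q}(s)$,
  so they have a common denominator $D$. If $x = p/q$ in lowest terms, then $q^k$ divides $D$ for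
  every $k$, which makes $q$ a unit. This replaces determinants and integral closures by
  divisibility in a factorial ring.
\<close>

theorem integrally_closed:
  fixes s :: "'k::field"
  assumes s: "transcendental s" and U: "finite U" and d: "d \<ge> 2"
    and pow: "\<And>u. u \<in> U \<Longrightarrow> u ^ d \<in> ev_span s (insert 1 U)"
    and x: "x \<in> adjoin s U" "x \<in> fractions s"
  shows "x \<in> range (ev s)"
proof -
  obtain p0 q0 where pq0: "q0 \<noteq> 0" "ev s q0 * x = ev s p0"
    using x(2) by (auto simp: fractions_def)
  \<comment> \<open>Reduce the fraction to lowest terms.\<close>
  define g where "g = gcd p0 q0"
  obtain p q where pq: "p0 = p * g" "q0 = q * g" "coprime p q"
    unfolding g_def using gcd_coprime_exists[of p0 q0] pq0(1) by (metis gcd_eq_0_iff)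
  have [simp]: "g \<noteq> 0" "q \<noteq> 0" using pq pq0 by auto
  then have "ev s g \<noteq> 0" using s by (simp add: transcendental_def)
  then have px: "ev s q * x = ev s p"
    using pq0(2) unfolding pq ev_mult by (simp add: mult.commute mult.left_commute)
  obtain W where W: "finite W" "adjoin s U \<subseteq> ev_span s W"
    using adjoin_finite_module[OF U d pow] by blast
  obtain D where D: "D \<noteq> 0"
    "\<And>x. x \<in> ev_span s (insert 1 W) \<Longrightarrow> x \<in> fractions s \<Longrightarrow> ev s D * x \<in> range (ev s)"
    using common_denominator[OF s W(1)] by blast
  have "q ^ k dvd D" for k
  proof -
    have qk: "ev s (q ^ k) * x ^ k = ev s (p ^ k)"
      by (simp add: px flip: power_mult_distrib)
    have "x ^ k \<in> ev_span s (insert 1 W)"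
      using W(2) adjoin.power_closed[OF x(1)] ev_module.span_mono[of W "insert 1 W" s] by blast
    moreover have "x ^ k \<in> fractions s"
      unfolding fractions_def using qk by (metis (mono_tags, lifting) \<open>q \<noteq> 0\<close> mem_Collect_eq power_not_zero)
    ultimately obtain r where r: "ev s D * x ^ k = ev s r" using D(2) by blast
    have "ev s (D * p ^ k) = ev s (q ^ k * r)"
      unfolding ev_mult qk[symmetric] r[symmetric] by (simp only: mult.left_commute)
    then have "D * p ^ k = q ^ k * r"
      using transcendental_ev_eq_iff[OF s] by blast
    then have "q ^ k dvd D * p ^ k" by simp
    moreover have "coprime (q ^ k) (p ^ k)" using pq(3) by (simp add: coprime_commute)
    ultimately show ?thesis using coprime_dvd_mult_left_iff by blast
  qed
  then have "\<not> finite {n. q ^ n dvd D}" by simp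
  then have "is_unit q" using finite_divisor_powers[OF D(1)] by blast
  then obtain r where "1 = q * r" by blast
  then have "ev s q * ev s r = 1" using ev_mult ev_1 by metis
  then have "x = ev s (p * r)"
    using px by (metis ev_mult mult.commute mult.left_commute mult_1)
  then show ?thesis by blast
qed

section \<open>Power sums and coefficients\<close>

locale type_subfield = type_subring R for R :: "'k::field set" +
  assumes inverse_closed [simp, intro]: "x \<in> R \<Longrightarrow> inverse x \<in> R"

lemma type_subfield_fractions:
  fixes s :: "'k::field"
  assumes s: "transcendental s"
  shows "type_subfield (fractions s)"
proof
  have nz: "ev s q \<noteq> 0" if "q \<noteq> 0" for q
    using s that by (simp add: transcendental_def)
  have I: "x \<in> fractions s" if "q \<noteq> 0" "ev s q * x = ev s p" for p q x
    using that unfolding fractions_def by blast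
  have E: "\<exists>p q. q \<noteq> 0 \<and> ev s q * x = ev s p" if "x \<in> fractions s" for x
    using that unfolding fractions_def by blast
  show "1 \<in> fractions s"
    by (rule I[of 1 _ 1]) simp_all
  show "- x \<in> fractions s" if x: "x \<in> fractions s" for x
  proof -
    obtain p q where "q \<noteq> 0" "ev s q * x = ev s p" using E[OF x] by blast
    then show ?thesis by (intro I[of q _ "- p"]) simp_all
  qed
  show "x + y \<in> fractions s" "x * y \<in> fractions s" if x: "x \<in> fractions s" and y: "y \<in> fractions s" for x y
  proof -
    obtain p q where pq: "q \<noteq> 0" "ev s q * x = ev s p" using E[OF x] by blast
    obtain p' q' where pq': "q' \<noteq> 0" "ev s q' * y = ev s p'" using E[OF y] by blast
    show "x + y \<in> fractions s"
      using pq pq' by (intro I[of "q * q'" _ "q' * p + q * p'"])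
        (simp_all add: distrib_left flip: pq(2) pq'(2))
    have "ev s (q * q') * (x * y) = ev s (p * p')"
      by (simp flip: pq(2) pq'(2))
    then show "x * y \<in> fractions s"
      using pq(1) pq'(1) by (intro I[of "q * q'" _ "p * p'"]) auto
  qed
  show "inverse x \<in> fractions s" if x: "x \<in> fractions s" for x
  proof (cases "x = 0")
    case True
    then show ?thesis by (intro I[of 1 _ 0]) simp_all
  next
    case False
    obtain p q where pq: "q \<noteq> 0" "ev s q * x = ev s p" using E[OF x] by blast
    have "ev s p \<noteq> 0" using False pq nz[of q] by (simp flip: pq(2))
    then have "p \<noteq> 0" by auto
    moreover have "ev s p * inverse x = ev s q"
      using False by (simp flip: pq(2))
    ultimately show ?thesis by (intro I)
  qed
qed

lemma ev_in_fractions: "ev s p \<in> fractions s"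
  unfolding fractions_def by (intro CollectI exI[of _ p] exI[of _ 1]) simp

lemma base_point_in_fractions: "s \<in> fractions s"
  using ev_in_fractions[of s "[:0, 1:]"] by simp

text \<open>
  Comparison of coefficients in the logarithmic derivative
  $Q' = - Q \cdot \sum_k p_{k+1} X^k$ of $Q = \prod_i (1 - h_i X)$, where $p_k$ is the $k$-th power
  sum of the $h_i$.
\<close>

lemma newton_identity:
  fixes h :: "'i \<Rightarrow> 'k::field"
  assumes "finite S"
  defines "Q \<equiv> \<Prod>i\<in>S. [:1, - h i:]"
  shows "of_nat (Suc n) * coeff Q (Suc n) = - (\<Sum>j\<le>n. coeff Q j * (\<Sum>i\<in>S. h i ^ Suc (n - j)))"
proof -
  define G where "G T = Abs_fps (\<lambda>k. \<Sum>i\<in>T. h i ^ Suc k)" for T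
  have "fps_deriv (fps_of_poly (\<Prod>i\<in>S. [:1, - h i:])) = - fps_of_poly (\<Prod>i\<in>S. [:1, - h i:]) * G S"
    using assms(1)
  proof (induction S rule: finite_induct)
    case empty
    show ?case by (simp add: G_def fps_eq_iff)
  next
    case (insert i S)
    define a where "a = h i"
    define L where "L = fps_of_poly [:1, - a:]"
    define P where "P = fps_of_poly (\<Prod>i\<in>S. [:1, - h i:])"
    define g where "g = Abs_fps (\<lambda>k. a ^ Suc k)"
    have L: "L = 1 - fps_const a * fps_X"
      by (simp add: L_def fps_of_poly_pCons fps_eq_iff)
    have "L * g = fps_const a"
    proof (rule fps_ext)
      fix n show "(L * g) $ n = fps_const a $ n"
        by (cases n) (simp_all add: L g_def left_diff_distrib mult.assoc)
    qed
    have G: "G (insert i S) = g + G S"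
      using insert.hyps by (simp add: G_def g_def fps_eq_iff a_def)
    have dL: "fps_deriv L = - fps_const a"
      by (simp add: L)
    have "fps_deriv (fps_of_poly (\<Prod>i\<in>insert i S. [:1, - h i:])) = fps_deriv (L * P)"
      unfolding L_def P_def a_def prod.insert[OF insert.hyps] fps_of_poly_mult ..
    also have "\<dots> = - fps_const a * P - L * P * G S"
      using insert.IH by (simp add: dL P_def algebra_simps)
    also have "\<dots> = - (L * P) * G (insert i S)"
      unfolding G \<open>L * g = fps_const a\<close>[symmetric] by (simp add: algebra_simps)
    also have "L * P = fps_of_poly (\<Prod>i\<in>insert i S. [:1, - h i:])"
      unfolding L_def P_def a_def prod.insert[OF insert.hyps] fps_of_poly_mult ..
    finally show ?case .
  qed
  from arg_cong[OF this, of "\<lambda>F. F $ n"] show ?thesis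
    by (simp add: Q_def[symmetric] G_def fps_mult_nth atLeast0AtMost sum_negf)
qed

lemma degree_prod_linear: "degree (\<Prod>i\<in>S. [:- h i, 1 :: 'k::field:]) = card S"
proof (cases "finite S")
  case True
  then show ?thesis by (subst degree_prod_eq_sum_degree) auto
qed simp

lemma monic_prod_linear: "lead_coeff (\<Prod>i\<in>S. [:- h i, 1 :: 'k::field:]) = 1"
  by (simp add: lead_coeff_prod)

lemma coeff_prod_reversed_linear:
  fixes h :: "'i \<Rightarrow> 'k::field"
  assumes "finite S"
  shows "coeff (\<Prod>i\<in>S. [:1, - h i:]) n =
    (if n > card S then 0 else coeff (\<Prod>i\<in>S. [:- h i, 1:]) (card S - n))"
proof -
  have "reflect_poly (\<Prod>i\<in>S. [:- h i, 1:]) = (\<Prod>i\<in>S. [:1, - h i:])"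
    unfolding reflect_poly_prod
    by (intro prod.cong refl) (simp add: reflect_poly_pCons' monom_Suc monom_0)
  then show ?thesis
    using coeff_reflect_poly[of "\<Prod>i\<in>S. [:- h i, 1:]" n] by (simp add: degree_prod_linear)
qed

context type_subfield
begin

text \<open>
  Newton's identity, solved for the power sum of highest index.
\<close>

lemma power_sum_closed:
  assumes S: "finite S" and P: "(\<Prod>i\<in>S. [:- h i, 1:]) \<in> poly_over"
  shows "(\<Sum>i\<in>S. h i ^ k) \<in> R"
proof (induction k rule: less_induct)
  case (less k)
  define Q where "Q = (\<Prod>i\<in>S. [:1, - h i:])"
  have Q: "coeff Q n \<in> R" for n
    using coeff_poly_over[OF P] by (simp add: Q_def coeff_prod_reversed_linear[OF S])
  show ?case
  proof (cases k)
    case 0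
    then show ?thesis by simp
  next
    case (Suc n)
    have Q0: "coeff Q 0 = 1"
      by (simp add: Q_def poly_prod flip: poly_0_coeff_0)
    have "{..n} = insert 0 {1..n}" by auto
    then have "of_nat (Suc n) * coeff Q (Suc n) =
        - ((\<Sum>i\<in>S. h i ^ Suc n) + (\<Sum>j=1..n. coeff Q j * (\<Sum>i\<in>S. h i ^ Suc (n - j))))"
      using newton_identity[OF S, of n h] by (simp add: Q_def[symmetric] Q0)
    then have "(\<Sum>i\<in>S. h i ^ k) =
        - (of_nat (Suc n) * coeff Q (Suc n)) - (\<Sum>j=1..n. coeff Q j * (\<Sum>i\<in>S. h i ^ Suc (n - j)))"
      by (simp add: Suc)
    also have "\<dots> \<in> R"
      by (intro diff_closed uminus_closed mult_closed of_nat_closed Q sum_closed less.IH)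
         (auto simp: Suc)
    finally show ?thesis .
  qed
qed

text \<open>
  Newton's identity, solved for the coefficient of highest index. The division by that index is where
  characteristic $0$ enters. The statement takes the place of the fundamental theorem on symmetric
  functions, and it applies to subsets of the roots of a polynomial as soon as their power sums are
  known.
\<close>

lemma prod_linear_poly_over:
  assumes char0: "\<And>n. n > 0 \<Longrightarrow> (of_nat n :: 'k) \<noteq> 0"
    and S: "finite S" and sums: "\<And>k. k > 0 \<Longrightarrow> (\<Sum>i\<in>S. h i ^ k) \<in> R"
  shows "(\<Prod>i\<in>S. [:- h i, 1:]) \<in> poly_over"
proof (rule poly_overI)
  fix n
  define Q where "Q = (\<Prod>i\<in>S. [:1, - h i:])"
  have Q: "coeff Q n \<in> R" for n
  proof (induction n rule: less_induct)
    case (less n)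
    show ?case
    proof (cases n)
      case 0
      then show ?thesis by (simp add: Q_def poly_prod flip: poly_0_coeff_0)
    next
      case (Suc k)
      have "coeff Q n = inverse (of_nat n) * (of_nat (Suc k) * coeff Q (Suc k))"
        using char0[of n] by (simp add: Suc del: of_nat_Suc)
      also have "\<dots> = inverse (of_nat n) * - (\<Sum>j\<le>k. coeff Q j * (\<Sum>i\<in>S. h i ^ Suc (k - j)))"
        unfolding Q_def newton_identity[OF S] ..
      also have "\<dots> \<in> R"
        by (intro mult_closed inverse_closed of_nat_closed uminus_closed sum_closed less.IH sums)
           (auto simp: Suc)
      finally show ?thesis .
    qed
  qed
  show "coeff (\<Prod>i\<in>S. [:- h i, 1:]) n \<in> R"
  proof (cases "n \<le> card S")
    case True
    then have "card S - (card S - n) = n" "\<not> card S - n > card S" by linarith+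
    then show ?thesis
      using Q[of "card S - n"] by (simp add: Q_def coeff_prod_reversed_linear[OF S])
  next
    case False
    then show ?thesis
      by (simp add: coeff_eq_0 degree_prod_linear)
  qed
qed

end

section \<open>Periodic points and cycles of a map\<close>

definition fixed_points :: "('a \<Rightarrow> 'a) \<Rightarrow> nat \<Rightarrow> 'a set" where
  "fixed_points f m = {z. (f ^^ m) z = z}"

definition exact_period :: "('a \<Rightarrow> 'a) \<Rightarrow> nat \<Rightarrow> 'a set" where
  "exact_period f m = {z \<in> fixed_points f m. \<forall>k. 0 < k \<and> k < m \<longrightarrow> z \<notin> fixed_points f k}"

definition cycle_of :: "('a \<Rightarrow> 'a) \<Rightarrow> 'a \<Rightarrow> 'a set" where
  "cycle_of f z = range (\<lambda>i. (f ^^ i) z)"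

definition cycles :: "('a \<Rightarrow> 'a) \<Rightarrow> nat \<Rightarrow> 'a set set" where
  "cycles f m = cycle_of f ` exact_period f m"

lemma exact_period_subset: "exact_period f m \<subseteq> fixed_points f m"
  by (auto simp: exact_period_def)

lemma fixed_points_mult:
  assumes "z \<in> fixed_points f k"
  shows "z \<in> fixed_points f (k * n)"
  using assms by (induction n) (auto simp: fixed_points_def funpow_add)

lemma exact_period_dvd:
  assumes z: "z \<in> exact_period f k" "k > 0" and m: "z \<in> fixed_points f m"
  shows "k dvd m"
proof -
  have "(f ^^ (m mod k)) z = z"
    using funpow_mod_eq[of k f z m] z m by (auto simp: exact_period_def fixed_points_def)
  moreover have "m mod k < k" using \<open>k > 0\<close> by simp
  ultimately have "m mod k = 0"
    using z(1) by (auto simp: exact_period_def fixed_points_def)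
  then show ?thesis by auto
qed

text \<open>
  The least positive period of $z$ divides every period of $z$.
\<close>

lemma fixed_points_eq_UN:
  assumes "m > 0"
  shows "fixed_points f m = (\<Union>k\<in>{k. k dvd m}. exact_period f k)"
proof safe
  fix z assume z: "z \<in> fixed_points f m"
  define k where "k = (LEAST k. k > 0 \<and> z \<in> fixed_points f k)"
  have k: "k > 0 \<and> z \<in> fixed_points f k"
    unfolding k_def by (rule LeastI[of _ m]) (use z assms in auto)
  have "z \<in> exact_period f k"
    unfolding exact_period_def using k not_less_Least[of _ "\<lambda>k. k > 0 \<and> z \<in> fixed_points f k"]
    unfolding k_def[symmetric] by blast
  then show "z \<in> (\<Union>k\<in>{k. k dvd m}. exact_period f k)"
    using exact_period_dvd[of z f k m] k z by blast
next
  fix z k assume "k dvd m" "z \<in> exact_period f k"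
  then show "z \<in> fixed_points f m"
    using fixed_points_mult[of z f k] exact_period_subset[of f k] by (auto elim!: dvdE)
qed

lemma exact_period_disjoint:
  assumes "j > 0" "k > 0" "j \<noteq> k"
  shows "exact_period f j \<inter> exact_period f k = {}"
proof (rule ccontr)
  assume "exact_period f j \<inter> exact_period f k \<noteq> {}"
  then obtain z where z: "z \<in> exact_period f j" "z \<in> exact_period f k" by blast
  then have "z \<in> fixed_points f j" "z \<in> fixed_points f k"
    using exact_period_subset by fast+
  then have "j dvd k" "k dvd j"
    using exact_period_dvd[OF z(1) assms(1)] exact_period_dvd[OF z(2) assms(2)] by simp_all
  then show False using assms by (simp add: dvd_antisym)
qed

lemma finite_exact_period:
  assumes "m > 0" "finite (fixed_points f m)" "k dvd m"
  shows "finite (exact_period f k)"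
  using assms(2,3) unfolding fixed_points_eq_UN[OF assms(1)]
  by (elim rev_finite_subset) auto

lemma sum_fixed_points:
  assumes "m > 0" "finite (fixed_points f m)"
  shows "(\<Sum>z\<in>fixed_points f m. h z) = (\<Sum>k | k dvd m. \<Sum>z\<in>exact_period f k. h z)"
  unfolding fixed_points_eq_UN[OF assms(1)]
proof (rule sum.UNION_disjoint)
  show "\<forall>k\<in>{k. k dvd m}. finite (exact_period f k)"
    using finite_exact_period[OF assms] by blast
  show "\<forall>j\<in>{k. k dvd m}. \<forall>k\<in>{k. k dvd m}. j \<noteq> k \<longrightarrow> exact_period f j \<inter> exact_period f k = {}"
    by (intro ballI impI exact_period_disjoint) (auto intro: dvd_pos_nat[OF assms(1)])
qed (use assms in simp)

lemma prod_fixed_points: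
  assumes "m > 0" "finite (fixed_points f m)"
  shows "(\<Prod>z\<in>fixed_points f m. h z) = (\<Prod>k | k dvd m. \<Prod>z\<in>exact_period f k. h z)"
  unfolding fixed_points_eq_UN[OF assms(1)]
proof (rule prod.UNION_disjoint)
  show "\<forall>k\<in>{k. k dvd m}. finite (exact_period f k)"
    using finite_exact_period[OF assms] by blast
  show "\<forall>j\<in>{k. k dvd m}. \<forall>k\<in>{k. k dvd m}. j \<noteq> k \<longrightarrow> exact_period f j \<inter> exact_period f k = {}"
    by (intro ballI impI exact_period_disjoint) (auto intro: dvd_pos_nat[OF assms(1)])
qed (use assms in simp)

lemma exact_period_step:
  assumes "z \<in> exact_period f m" "m > 0"
  shows "f z \<in> exact_period f m"
proof -
  have z: "(f ^^ m) z = z" using assms by (auto simp: exact_period_def fixed_points_def)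
  have "f z \<in> fixed_points f m"
    using z funpow_swap1[of f m z] by (simp add: fixed_points_def)
  moreover have "z \<in> fixed_points f k" if "f z \<in> fixed_points f k" for k
  proof -
    have "(f ^^ (m - 1)) (f z) = z"
      using z funpow_Suc_right[of "m - 1" f] assms(2) by simp
    then have "(f ^^ k) z = (f ^^ k) ((f ^^ (m - 1)) (f z))"
      by simp
    also have "\<dots> = (f ^^ (m - 1)) ((f ^^ k) (f z))"
      using funpow_add[of k "m - 1" f] funpow_add[of "m - 1" k f] by (metis add.commute o_apply)
    also have "\<dots> = z"
      using that \<open>(f ^^ (m - 1)) (f z) = z\<close> by (simp add: fixed_points_def)
    finally show ?thesis by (simp add: fixed_points_def)
  qed
  ultimately show ?thesis using assms(1) by (auto simp: exact_period_def)
qed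

lemma exact_period_funpow:
  assumes "z \<in> exact_period f m" "m > 0"
  shows "(f ^^ i) z \<in> exact_period f m"
proof (induction i)
  case (Suc i)
  then show ?case using exact_period_step[of "(f ^^ i) z" f m] assms(2) by simp
qed (simp add: assms)

lemma cycle_of_eq_image:
  assumes "z \<in> exact_period f m" "m > 0"
  shows "cycle_of f z = (\<lambda>i. (f ^^ i) z) ` {..<m}"
proof -
  have "(f ^^ i) z \<in> (\<lambda>i. (f ^^ i) z) ` {..<m}" for i
  proof
    show "(f ^^ i) z = (f ^^ (i mod m)) z"
      using funpow_mod_eq[where f = f and n = m and m = i] assms by (auto simp: exact_period_def fixed_points_def)
  qed (use assms in auto)
  then show ?thesis unfolding cycle_of_def by blast
qed

lemma inj_on_exact_period:
  assumes z: "z \<in> exact_period f m"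
  shows "inj_on (\<lambda>i. (f ^^ i) z) {..<m}"
proof (rule linorder_inj_onI)
  fix i j assume ij: "i < j" "i \<in> {..<m}" "j \<in> {..<m}"
  show "(f ^^ i) z \<noteq> (f ^^ j) z"
  proof
    assume eq: "(f ^^ i) z = (f ^^ j) z"
    have fz: "(f ^^ m) z = z" using z by (auto simp: exact_period_def fixed_points_def)
    have "(f ^^ (m - j)) ((f ^^ i) z) = (f ^^ (m - j + i)) z"
      by (simp add: funpow_add)
    moreover have "(f ^^ (m - j)) ((f ^^ j) z) = (f ^^ (m - j + j)) z"
      by (simp add: funpow_add)
    ultimately have "(f ^^ (m - j + i)) z = z"
      using eq fz ij by simp
    then show False
      using z ij by (auto simp: exact_period_def fixed_points_def)
  qed
qed auto

lemma card_cycle_of: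
  assumes "z \<in> exact_period f m" "m > 0"
  shows "card (cycle_of f z) = m"
  unfolding cycle_of_eq_image[OF assms] card_image[OF inj_on_exact_period[OF assms(1)]] by simp

lemma cycle_of_eq:
  assumes z: "z \<in> exact_period f m" "m > 0" and w: "w \<in> cycle_of f z"
  shows "cycle_of f w = cycle_of f z"
proof -
  have sub: "cycle_of f y \<subseteq> cycle_of f x" if "y \<in> cycle_of f x" for x y
  proof -
    obtain i where "y = (f ^^ i) x" using \<open>y \<in> cycle_of f x\<close> by (auto simp: cycle_of_def)
    then have "(f ^^ j) y = (f ^^ (j + i)) x" for j by (simp add: funpow_add)
    then show ?thesis by (auto simp: cycle_of_def)
  qed
  obtain i where i: "w = (f ^^ i) z" "i < m"
    using w by (auto simp: cycle_of_eq_image[OF z])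
  have "(f ^^ (m - i)) w = (f ^^ (m - i + i)) z" by (simp add: i funpow_add)
  then have "z = (f ^^ (m - i)) w"
    using i z by (simp add: exact_period_def fixed_points_def)
  then have "z \<in> cycle_of f w" by (auto simp: cycle_of_def)
  then show ?thesis using sub w by blast
qed

lemma cycle_of_self: "z \<in> cycle_of f z"
  unfolding cycle_of_def by (rule image_eqI[of _ _ 0]) simp_all

lemma Union_cycles:
  assumes "m > 0"
  shows "\<Union> (cycles f m) = exact_period f m"
proof
  show "\<Union> (cycles f m) \<subseteq> exact_period f m"
    using exact_period_funpow[where f = f and m = m, OF _ assms] by (auto simp: cycles_def cycle_of_def)
  show "exact_period f m \<subseteq> \<Union> (cycles f m)"
    using cycle_of_self[where f = f] by (auto simp: cycles_def)
qed

lemma cycles_disjoint: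
  assumes "m > 0" "C \<in> cycles f m" "D \<in> cycles f m" "C \<noteq> D"
  shows "C \<inter> D = {}"
proof (rule ccontr)
  assume "C \<inter> D \<noteq> {}"
  then obtain w where w: "w \<in> C" "w \<in> D" by blast
  obtain y z where "C = cycle_of f y" "D = cycle_of f z" "y \<in> exact_period f m" "z \<in> exact_period f m"
    using assms(2,3) by (auto simp: cycles_def)
  then have "C = D"
    using cycle_of_eq[of y f m w] cycle_of_eq[of z f m w] w assms(1) by simp
  then show False using assms(4) by simp
qed

lemma card_cycles:
  assumes "m > 0" "C \<in> cycles f m"
  shows "card C = m"
proof -
  obtain z where "C = cycle_of f z" "z \<in> exact_period f m"
    using assms(2) by (auto simp: cycles_def)
  then show ?thesis using card_cycle_of[of z f m] assms(1) by simp
qed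

lemma finite_in_cycles:
  assumes "m > 0" "C \<in> cycles f m"
  shows "finite C"
  using card_cycles[OF assms] assms(1) by (intro card_ge_0_finite) simp

text \<open>
  The cycles partition the points of exact period $m$, and each of them has $m$ elements.
\<close>

lemma prod_cycles:
  assumes "m > 0"
  shows "(\<Prod>z\<in>exact_period f m. h z) = (\<Prod>C\<in>cycles f m. \<Prod>z\<in>C. h z)"
  unfolding Union_cycles[OF assms, symmetric]
proof (subst prod.Union_disjoint)
  show "\<forall>C\<in>cycles f m. finite C"
    using finite_in_cycles[OF assms] by blast
  show "\<forall>C\<in>cycles f m. \<forall>D\<in>cycles f m. C \<noteq> D \<longrightarrow> C \<inter> D = {}"
    using cycles_disjoint[OF assms] by blast
qed simp

lemma sum_cycles:
  assumes "m > 0"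
  shows "(\<Sum>z\<in>exact_period f m. h z) = (\<Sum>C\<in>cycles f m. \<Sum>z\<in>C. h z)"
  unfolding Union_cycles[OF assms, symmetric]
proof (subst sum.Union_disjoint)
  show "\<forall>C\<in>cycles f m. finite C"
    using finite_in_cycles[OF assms] by blast
  show "\<forall>C\<in>cycles f m. \<forall>D\<in>cycles f m. C \<noteq> D \<longrightarrow> C \<inter> D = {}"
    using cycles_disjoint[OF assms] by blast
qed simp

lemma card_exact_period:
  assumes "m > 0"
  shows "card (exact_period f m) = m * card (cycles f m)"
proof -
  have "card (exact_period f m) = (\<Sum>C\<in>cycles f m. card C)"
    using sum_cycles[OF assms, where f = f and h = "\<lambda>_. 1 :: nat"] unfolding card_eq_sum .
  also have "\<dots> = (\<Sum>C\<in>cycles f m. m)"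
    by (intro sum.cong refl card_cycles[OF assms])
  finally show ?thesis by simp
qed

lemma prod_cycle_of:
  assumes "z \<in> exact_period f m" "m > 0"
  shows "(\<Prod>w\<in>cycle_of f z. h w) = (\<Prod>i<m. h ((f ^^ i) z))"
  unfolding cycle_of_eq_image[OF assms]
  using inj_on_exact_period[OF assms(1)] by (simp add: prod.reindex)

section \<open>Periodic points of unicritical polynomials\<close>

lemma pcompose_power: "pcompose (p ^ n) q = pcompose p q ^ n"
  by (induction n) (simp_all add: pcompose_mult pcompose_1)

lemma iterate_0: "iterate d 0 = [:0, 1:]"
  by (simp add: iterate_def)

lemma iterate_Suc: "iterate d (Suc k) = iterate d k ^ d + [:[:0, 1:]:]"
  by (simp add: iterate_def unicrit_def pcompose_add pcompose_power pcompose_pCons)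

lemma ev_sum: "ev s (sum h A) = (\<Sum>i\<in>A. ev s (h i))"
  by (induction A rule: infinite_finite_induct) simp_all

lemma map_poly_ev_add: "map_poly (ev s) (p + q) = map_poly (ev s) p + map_poly (ev s) q"
  by (rule poly_eqI) (simp add: coeff_map_poly)

lemma map_poly_ev_diff: "map_poly (ev s) (p - q) = map_poly (ev s) p - map_poly (ev s) q"
  by (rule poly_eqI) (simp add: coeff_map_poly)

lemma map_poly_ev_mult: "map_poly (ev s) (p * q) = map_poly (ev s) p * map_poly (ev s) q"
  by (rule poly_eqI) (simp add: coeff_map_poly coeff_mult ev_sum)

lemma map_poly_ev_power: "map_poly (ev s) (p ^ n) = map_poly (ev s) p ^ n"
  by (induction n) (simp_all add: map_poly_ev_mult)

lemma map_poly_ev_prod: "map_poly (ev s) (prod h A) = (\<Prod>i\<in>A. map_poly (ev s) (h i))"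
  by (induction A rule: infinite_finite_induct) (simp_all add: map_poly_ev_mult)

lemma map_poly_ev_eq_iff:
  assumes "transcendental s"
  shows "map_poly (ev s) p = map_poly (ev s) q \<longleftrightarrow> p = q"
  by (simp add: poly_eq_iff coeff_map_poly transcendental_ev_eq_iff[OF assms])

text \<open>
  Coefficients in $\mathbb{Z}[s]$ come from unique integer polynomials, so a polynomial with such
  coefficients is the image of a polynomial over \<^typ>\<open>int poly\<close>.
\<close>

lemma ex_map_poly_ev:
  assumes s: "transcendental s" and p: "\<And>n. coeff p n \<in> range (ev s)"
  obtains P where "map_poly (ev s) P = p"
proof
  have "inj (ev s)" using transcendental_ev_eq_iff[OF s] by (auto simp: inj_def)
  then have [simp]: "inv_into UNIV (ev s) 0 = 0" by (metis ev_0 inv_f_f)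
  show "map_poly (ev s) (map_poly (inv_into UNIV (ev s)) p) = p"
    using p by (intro poly_eqI) (simp add: coeff_map_poly f_inv_into_f)
qed

lemma proots_prod_linear: "proots (\<Prod>z\<in>#A. [:- z, 1 :: 'k::idom:]) = A"
proof (induction A)
  case (add z A)
  have nz: "(\<Prod>z\<in>#A. [:- z, 1 :: 'k:]) \<noteq> 0" by auto
  have "proots ([:- z, 1:] * (\<Prod>z\<in>#A. [:- z, 1:])) = {#z#} + A"
    using nz by (subst proots_mult) (simp_all add: add.IH del: mult_pCons_left)
  then show ?case by (simp del: mult_pCons_left)
qed simp

text \<open>
  The arguments only need an algebraically closed field that contains a transcendental element $c$.
\<close>

locale unicritical =
  fixes c :: "'k::alg_closed_field" and d :: nat
  assumes d: "d \<ge> 2" and c: "transcendental c"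
begin

definition f :: "'k \<Rightarrow> 'k" where
  "f z = z ^ d + c"

definition iter_poly :: "nat \<Rightarrow> 'k poly" where
  "iter_poly k = map_poly (ev c) (iterate d k)"

abbreviation Fix :: "nat \<Rightarrow> 'k set" where
  "Fix \<equiv> fixed_points f"

abbreviation Per :: "nat \<Rightarrow> 'k set" where
  "Per \<equiv> exact_period f"

lemma of_nat_nonzero: "n > 0 \<Longrightarrow> (of_nat n :: 'k) \<noteq> 0"
  using transcendental_of_int_eq_0_iff[OF c, of "int n"] by simp

lemma c_nonzero: "c \<noteq> 0"
  using transcendental_nonzero[OF c] .

lemma iter_poly_0: "iter_poly 0 = [:0, 1:]"
  by (simp add: iter_poly_def iterate_0 map_poly_pCons)

lemma iter_poly_Suc: "iter_poly (Suc k) = iter_poly k ^ d + [:c:]"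
  by (simp add: iter_poly_def iterate_Suc map_poly_ev_add map_poly_ev_power map_poly_pCons)

lemma poly_iter_poly: "poly (iter_poly k) z = (f ^^ k) z"
  by (induction k) (simp_all add: iter_poly_0 iter_poly_Suc f_def)

lemma degree_lead_coeff_iter_poly: "degree (iter_poly k) = d ^ k \<and> lead_coeff (iter_poly k) = 1"
proof (induction k)
  case 0
  then show ?case by (simp add: iter_poly_0)
next
  case (Suc k)
  have "degree (iter_poly k ^ d) = d ^ Suc k"
    using Suc by (subst degree_power_eq) auto
  moreover have "lead_coeff (iter_poly k ^ d) = 1"
    unfolding lead_coeff_power using Suc[THEN conjunct2] by (simp only: power_one)
  moreover have "degree [:c:] < d ^ Suc k"
    using d by simp
  ultimately show ?case
    unfolding iter_poly_Suc by (metis degree_add_eq_left lead_coeff_add_le add.commute)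
qed

lemma poly_pderiv_iter_poly:
  "poly (pderiv (iter_poly k)) z = (\<Prod>i<k. of_nat d * ((f ^^ i) z) ^ (d - 1))"
proof (induction k)
  case 0
  then show ?case by (simp add: iter_poly_0 pderiv_pCons)
next
  case (Suc k)
  then show ?case
    by (simp add: iter_poly_Suc pderiv_add pderiv_power pderiv_pCons poly_iter_poly mult_ac)
qed

lemma power_in_orbit_span:
  assumes "u \<in> U" "f u \<in> U"
  shows "u ^ d \<in> ev_span c (insert 1 U)"
proof -
  have "1 * f u - c * 1 \<in> ev_span c (insert 1 U)"
    using assms ev_module.span_scale[OF ev_module.span_base[of 1 "insert 1 U" c], of "[:0, 1:]"]
    by (intro ev_module.span_diff) (auto intro: ev_module.span_base)
  then show ?thesis by (simp add: f_def)
qed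

text \<open>
  If $d^m \prod_i z_i^{d-1} = 1$ on a cycle $(z_i)$, then $1/d = d^{m-1} \prod_i z_i^{d-1}$. The
  points of a cycle are integral over $\mathbb{Z}[c]$, as $z_i^d = z_{i+1} - c$, so $1/d$ would be an
  element of $\mathbb{Z}[c]$.
\<close>

lemma multiplier_neq_1:
  assumes z: "z \<in> Fix m" and m: "m > 0"
  shows "poly (pderiv (iter_poly m)) z \<noteq> 1"
proof
  assume eq: "poly (pderiv (iter_poly m)) z = 1"
  define U where "U = (\<lambda>i. (f ^^ i) z) ` {..<m}"
  have step: "f u \<in> U" if "u \<in> U" for u
  proof -
    obtain i where i: "i < m" "u = (f ^^ i) z" using \<open>u \<in> U\<close> by (auto simp: U_def)
    have "(f ^^ Suc i) z = (f ^^ (Suc i mod m)) z"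
      using funpow_mod_eq[of m f z "Suc i"] z by (simp add: fixed_points_def)
    then show ?thesis using m i by (auto simp: U_def)
  qed
  \<comment> \<open>This is $1/d$ if the multiplier is $1$.\<close>
  define x where "x = of_nat d ^ (m - 1) * (\<Prod>i<m. ((f ^^ i) z) ^ (d - 1))"
  have "of_nat d * x = (\<Prod>i<m. of_nat d * ((f ^^ i) z) ^ (d - 1))"
    using m by (simp add: x_def prod.distrib power_eq_if)
  then have dx: "of_nat d * x = 1"
    using eq by (simp add: poly_pderiv_iter_poly)
  have "x \<in> adjoin c U"
    unfolding x_def
    by (intro adjoin.mult_closed adjoin.prod_closed adjoin.power_closed adjoin.of_nat_closed adjoin_generator)
       (auto simp: U_def)
  moreover have "x \<in> fractions c"
    unfolding fractions_def using dx d
    by (intro CollectI exI[of _ 1] exI[of _ "[:int d:]"]) simp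
  moreover have "finite U" by (simp add: U_def)
  ultimately have "x \<in> range (ev c)"
    by (intro integrally_closed[OF c _ d power_in_orbit_span]) (simp_all add: step)
  then obtain r where "x = ev c r" by blast
  then have "ev c ([:int d:] * r) = ev c 1"
    using dx by simp
  then have "[:int d:] * r = 1"
    using transcendental_ev_eq_iff[OF c] by blast
  then have "int d * coeff r 0 = 1"
    by (metis coeff_pCons_0 coeff_mult_0 one_pCons)
  then show False
    using d by (metis dvd_triv_left int_dvd_int_iff nat_dvd_1_iff_1 of_nat_1 numeral_le_one_iff semiring_norm(69))
qed

lemma degree_lead_coeff_fixed_poly:
  assumes "m > 0"
  shows "degree (iter_poly m - [:0, 1:]) = d ^ m" "lead_coeff (iter_poly m - [:0, 1:]) = 1"
proof -
  have lt: "degree [:0, 1 :: 'k:] < d ^ m"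
    using d assms one_less_power[of d m] by simp
  then show deg: "degree (iter_poly m - [:0, 1:]) = d ^ m"
    using degree_lead_coeff_iter_poly[of m] degree_add_eq_left[of "- [:0, 1:]" "iter_poly m"]
    by (metis degree_minus uminus_add_conv_diff add.commute)
  show "lead_coeff (iter_poly m - [:0, 1:]) = 1"
    unfolding deg coeff_diff coeff_eq_0[OF lt] using degree_lead_coeff_iter_poly[of m] by (metis diff_zero)
qed

text \<open>
  A multiple root of $f^{\circ m}(z) - z$ would be a periodic point of multiplier $1$. Hence all
  roots are simple, and multiplicities never have to be discussed.
\<close>

lemma fixed_poly_eq_prod:
  assumes m: "m > 0"
  shows "iter_poly m - [:0, 1:] = (\<Prod>z\<in>Fix m. [:- z, 1:])"
    and "finite (Fix m)"
proof -
  define P where "P = iter_poly m - [:0, 1:]"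
  have lead: "lead_coeff P = 1"
    unfolding P_def by (rule degree_lead_coeff_fixed_poly(2)[OF m])
  then have P: "P \<noteq> 0" by auto
  have root: "poly P z = 0 \<longleftrightarrow> z \<in> Fix m" for z
    by (simp add: P_def poly_iter_poly fixed_points_def)
  show fin: "finite (Fix m)"
    using poly_roots_finite[OF P] by (simp add: root)
  have order: "order z P = (if z \<in> Fix m then 1 else 0)" for z
  proof (cases "z \<in> Fix m")
    case True
    have "order z P \<noteq> 0"
      using P order_root[of P z] root[of z] True by simp
    moreover have "\<not> order z P \<ge> 2"
    proof
      assume "order z P \<ge> 2"
      then have "[:- z, 1:] ^ 2 dvd P"
        by (simp add: order_divides)
      then obtain q where "P = [:- z, 1:] * ([:- z, 1:] * q)"
        unfolding power2_eq_square dvd_def mult.assoc by blast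
      then have "poly (pderiv P) z = 0"
        by (simp only: pderiv_mult poly_add poly_mult) simp
      then show False
        using multiplier_neq_1[OF True m] by (simp add: P_def pderiv_diff pderiv_pCons)
    qed
    ultimately show ?thesis using True by simp
  next
    case False
    then show ?thesis using root[of z] by (simp add: order_0I)
  qed
  obtain A where A: "P = smult (lead_coeff P) (\<Prod>z\<in>#A. [:- z, 1:])"
    using alg_closed_imp_factorization[OF P] by blast
  have "P = (\<Prod>z\<in>#A. [:- z, 1:])"
    using A unfolding lead by simp
  moreover from this have "proots P = A"
    by (simp only: proots_prod_linear)
  moreover have "proots P = mset_set (Fix m)"
    by (rule multiset_eqI) (simp add: P order count_mset_set' fin)
  ultimately show "iter_poly m - [:0, 1:] = (\<Prod>z\<in>Fix m. [:- z, 1:])"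
    by (simp add: P_def prod_unfold_prod_mset)
qed

lemma finite_Per: "m > 0 \<Longrightarrow> finite (Per m)"
  using finite_subset[OF exact_period_subset fixed_poly_eq_prod(2)] .

lemma card_Fix:
  assumes m: "m > 0"
  shows "card (Fix m) = d ^ m"
  using degree_lead_coeff_fixed_poly(1)[OF m] unfolding fixed_poly_eq_prod(1)[OF m] degree_prod_linear .

text \<open>
  The iterate in the coordinate $y = l z$: the map $y \mapsto l f^{\circ k}(y/l)$.
\<close>

definition scaled_iter :: "'k \<Rightarrow> nat \<Rightarrow> 'k poly" where
  "scaled_iter l k = smult l (pcompose (iter_poly k) [:0, inverse l:])"

lemma scaled_iter_0: "l \<noteq> 0 \<Longrightarrow> scaled_iter l 0 = [:0, 1:]"
  by (simp add: scaled_iter_def iter_poly_0 pcompose_pCons)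

lemma scaled_iter_Suc:
  assumes "l \<noteq> 0"
  shows "scaled_iter l (Suc k) = smult (inverse (l ^ (d - 1))) (scaled_iter l k ^ d) + [:l * c:]"
proof -
  have "l ^ d = l * l ^ (d - 1)" using d by (simp add: power_eq_if)
  then have "inverse (l ^ (d - 1)) * l ^ d = l" using assms by simp
  then show ?thesis
    by (simp add: scaled_iter_def iter_poly_Suc pcompose_add pcompose_power smult_add_right
      smult_power pcompose_pCons)
qed

lemma poly_scaled_iter: "l \<noteq> 0 \<Longrightarrow> poly (scaled_iter l k) (l * z) = l * (f ^^ k) z"
  by (simp add: scaled_iter_def poly_pcompose poly_iter_poly mult.commute[of "l * z"] flip: mult.assoc)

text \<open>
  In the coordinate $y = l z$ the map $f$ becomes $y \mapsto l^{1-d} y^d + l c$. It has coefficients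
  in $\mathbb{Q}(c)$ for $l = 1$, and even in $\mathbb{Q}(c^{d-1})$ for $l = 1/c$.
\<close>

lemma scaled_iter_poly_over:
  assumes R: "type_subfield R" and l: "l \<noteq> 0" "l ^ (d - 1) \<in> R" "l * c \<in> R"
  shows "scaled_iter l k \<in> type_subring.poly_over R"
proof -
  interpret type_subfield R by fact
  show ?thesis
  proof (induction k)
    case 0
    then show ?case
      using l by (simp add: scaled_iter_0 pCons_poly_over zero_poly_over)
  next
    case (Suc k)
    then show ?case
      unfolding scaled_iter_Suc[OF l(1)]
      using l by (intro add_poly_over smult_poly_over power_poly_over pCons_poly_over zero_poly_over
        inverse_closed)
  qed
qed

text \<open>
  The points $l z$ are the roots of $l f^{\circ m}(y/l) - y$.
\<close>

lemma power_sum_Fix: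
  assumes R: "type_subfield R" and l: "l \<noteq> 0" "l ^ (d - 1) \<in> R" "l * c \<in> R" and m: "m > 0"
  shows "(\<Sum>z\<in>Fix m. (l * z) ^ k) \<in> R"
proof -
  interpret type_subfield R by fact
  have "scaled_iter l m - [:0, 1:] = smult l (pcompose (iter_poly m - [:0, 1:]) [:0, inverse l:])"
    using l(1) by (simp add: scaled_iter_def pcompose_diff smult_diff_right pcompose_pCons)
  also have "\<dots> = smult l (\<Prod>z\<in>Fix m. [:- z, inverse l:])"
    unfolding fixed_poly_eq_prod(1)[OF m] by (simp add: pcompose_prod pcompose_pCons)
  also have "(\<Prod>z\<in>Fix m. [:- z, inverse l:]) = (\<Prod>z\<in>Fix m. smult (inverse l) [:- (l * z), 1:])"
    using l(1) by (intro prod.cong refl) (simp add: field_simps)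
  also have "\<dots> = smult (inverse l ^ card (Fix m)) (\<Prod>z\<in>Fix m. [:- (l * z), 1:])"
    by (simp only: prod_smult prod_constant)
  finally have eq: "scaled_iter l m - [:0, 1:] =
      smult (l * inverse l ^ card (Fix m)) (\<Prod>z\<in>Fix m. [:- (l * z), 1:])" (is "?L = smult ?a ?Q")
    by simp
  have "?a \<noteq> 0" using l(1) by simp
  have "?L \<in> poly_over"
    by (intro diff_poly_over scaled_iter_poly_over[OF R l] pCons_poly_over zero_poly_over) auto
  moreover have "lead_coeff ?L = ?a"
    unfolding eq lead_coeff_smult monic_prod_linear by simp
  ultimately have "?a \<in> R" by (metis coeff_poly_over)
  then have "smult (inverse ?a) ?L \<in> poly_over"
    using \<open>?L \<in> poly_over\<close> by (intro smult_poly_over inverse_closed)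
  then have "?Q \<in> poly_over"
    by (simp only: eq smult_smult left_inverse[OF \<open>?a \<noteq> 0\<close>] smult_1_left)
  then show ?thesis
    by (rule power_sum_closed[OF fixed_poly_eq_prod(2)[OF m]])
qed

text \<open>
  Induction on $m$: the sum over all points of period $m$ is the sum over the divisors $k$ of $m$ of
  the sums over the points of exact period $k$.
\<close>

lemma power_sum_Per:
  assumes R: "type_subfield R" and l: "l \<noteq> 0" "l ^ (d - 1) \<in> R" "l * c \<in> R" and m: "m > 0"
  shows "(\<Sum>z\<in>Per m. (l * z) ^ k) \<in> R"
  using m
proof (induction m rule: less_induct)
  case (less m)
  interpret type_subfield R by fact
  define S where "S = (\<lambda>j. \<Sum>z\<in>Per j. (l * z) ^ k)"
  have div: "{j. j dvd m} = insert m {j. j dvd m \<and> j < m}"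
    using less.prems by (auto dest: dvd_imp_le)
  have "(\<Sum>z\<in>Fix m. (l * z) ^ k) = (\<Sum>j | j dvd m. S j)"
    unfolding S_def by (rule sum_fixed_points[OF less.prems fixed_poly_eq_prod(2)[OF less.prems]])
  also have "\<dots> = S m + (\<Sum>j | j dvd m \<and> j < m. S j)"
    unfolding div by (subst sum.insert) auto
  finally have "S m = (\<Sum>z\<in>Fix m. (l * z) ^ k) - (\<Sum>j | j dvd m \<and> j < m. S j)"
    by simp
  also have "\<dots> \<in> R"
  proof (rule diff_closed[OF power_sum_Fix[OF R l less.prems] sum_closed])
    fix j assume "j \<in> {j. j dvd m \<and> j < m}"
    then show "S j \<in> R"
      using less.IH[of j] less.prems by (auto simp: S_def intro: dvd_pos_nat)
  qed
  finally show ?case by (simp add: S_def)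
qed

definition period_poly :: "nat \<Rightarrow> 'k poly" where
  "period_poly m = (\<Prod>z\<in>Per m. [:- z, 1:])"

text \<open>
  The coefficients lie in $\mathbb{Q}(c)$ by the power sums, and they are integral over
  $\mathbb{Z}[c]$ because the periodic points are.
\<close>

lemma period_poly_integral:
  assumes m: "m > 0"
  obtains \<Phi> where "map_poly (ev c) \<Phi> = period_poly m"
proof (rule ex_map_poly_ev[OF c])
  interpret Q: type_subfield "fractions c"
    by (rule type_subfield_fractions[OF c])
  have "period_poly m \<in> Q.poly_over"
    unfolding period_poly_def
  proof (rule Q.prod_linear_poly_over[OF of_nat_nonzero finite_Per[OF m]])
    show "(\<Sum>z\<in>Per m. z ^ k) \<in> fractions c" for k
      using power_sum_Per[OF type_subfield_fractions[OF c], of 1 m k] base_point_in_fractions[of c] m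
      by simp
  qed
  moreover have "period_poly m \<in> type_subring.poly_over (adjoin c (Per m))"
    unfolding period_poly_def
    by (intro adjoin.prod_poly_over adjoin.pCons_poly_over adjoin.zero_poly_over adjoin.uminus_closed
        adjoin_generator adjoin.one_closed)
  ultimately show "coeff (period_poly m) n \<in> range (ev c)" for n
    using exact_period_step[where f = f and m = m, OF _ m] finite_Per[OF m]
    by (intro integrally_closed[OF c _ d power_in_orbit_span])
       (auto intro: Q.coeff_poly_over adjoin.coeff_poly_over)
qed

end

section \<open>Integrality of the multiplier polynomial\<close>

text \<open>
  Substitution of $r X$ for $X$.
\<close>

lemma coeff_prod_linear_scaled:
  fixes h :: "'i \<Rightarrow> 'k::field"
  shows "r ^ n * coeff (\<Prod>i\<in>S. [:- (r * h i), 1:]) n = r ^ card S * coeff (\<Prod>i\<in>S. [:- h i, 1:]) n"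
proof -
  have "pcompose (\<Prod>i\<in>S. [:- (r * h i), 1:]) [:0, r:] = (\<Prod>i\<in>S. smult r [:- h i, 1:])"
    by (simp add: pcompose_prod pcompose_pCons)
  also have "\<dots> = smult (r ^ card S) (\<Prod>i\<in>S. [:- h i, 1:])"
    by (simp only: prod_smult prod_constant)
  finally have eq: "pcompose (\<Prod>i\<in>S. [:- (r * h i), 1:]) [:0, r:] = smult (r ^ card S) (\<Prod>i\<in>S. [:- h i, 1:])" .
  show ?thesis
    using arg_cong[OF eq, of "\<lambda>p. coeff p n"] unfolding coeff_pcompose_linear coeff_smult .
qed

context unicritical
begin

abbreviation Cyc :: "nat \<Rightarrow> 'k set set" where
  "Cyc \<equiv> cycles f"

text \<open>
  The product over the whole cycle shows that the multiplier does not depend on the chosen point.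
\<close>

definition cycle_multiplier :: "'k set \<Rightarrow> 'k" where
  "cycle_multiplier C = (\<Prod>z\<in>C. of_nat d * z ^ (d - 1))"

text \<open>
  One linear factor for each cycle. This is $\delta_m$ over the algebraically closed field; what
  remains is to find out where its coefficients lie.
\<close>

definition mult_poly :: "nat \<Rightarrow> 'k poly" where
  "mult_poly m = (\<Prod>C\<in>Cyc m. [:- cycle_multiplier C, 1:])"

lemma finite_Cyc: "m > 0 \<Longrightarrow> finite (Cyc m)"
  unfolding cycles_def using finite_Per by blast

lemma multiplier_eq_cycle_multiplier:
  assumes m: "m > 0" and C: "C \<in> Cyc m" and z: "z \<in> C"
  shows "poly (pderiv (iter_poly m)) z = cycle_multiplier C"
proof -
  obtain y where y: "C = cycle_of f y" "y \<in> Per m"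
    using C by (auto simp: cycles_def)
  then have Cz: "C = cycle_of f z"
    using cycle_of_eq[of y f m z] m z by simp
  have "z \<in> Per m"
    using Union_cycles[OF m, of f] C z by blast
  then show ?thesis
    unfolding cycle_multiplier_def Cz
    by (subst prod_cycle_of[of z f m]) (simp_all add: m poly_pderiv_iter_poly)
qed

lemma mult_poly_power:
  assumes m: "m > 0"
  shows "mult_poly m ^ m = (\<Prod>z\<in>Per m. [:- poly (pderiv (iter_poly m)) z, 1:])"
proof -
  have "(\<Prod>z\<in>Per m. [:- poly (pderiv (iter_poly m)) z, 1:]) =
      (\<Prod>C\<in>Cyc m. \<Prod>z\<in>C. [:- poly (pderiv (iter_poly m)) z, 1:])"
    by (rule prod_cycles[OF m])
  also have "\<dots> = (\<Prod>C\<in>Cyc m. [:- cycle_multiplier C, 1:] ^ m)"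
  proof (rule prod.cong[OF refl])
    fix C assume C: "C \<in> Cyc m"
    have "(\<Prod>z\<in>C. [:- poly (pderiv (iter_poly m)) z, 1:]) = (\<Prod>z\<in>C. [:- cycle_multiplier C, 1:])"
      by (rule prod.cong) (simp_all add: multiplier_eq_cycle_multiplier[OF m C])
    then show "(\<Prod>z\<in>C. [:- poly (pderiv (iter_poly m)) z, 1:]) = [:- cycle_multiplier C, 1:] ^ m"
      by (simp only: prod_constant card_cycles[OF m C])
  qed
  finally show ?thesis
    unfolding mult_poly_def prod_power_distrib[symmetric] by simp
qed

lemma prod_cycle_multiplier:
  assumes m: "m > 0"
  shows "(\<Prod>C\<in>Cyc m. cycle_multiplier C) = of_nat d ^ card (Per m) * (\<Prod>z\<in>Per m. z) ^ (d - 1)"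
  unfolding cycle_multiplier_def prod_cycles[OF m, symmetric]
  by (simp add: prod.distrib prod_power_distrib)

definition t_poly :: "int poly" where
  "t_poly = Polynomial.monom (int d ^ d) (d - 1)"

definition t :: 'k where
  "t = ev c t_poly"

lemma t_eq: "t = of_nat d ^ d * c ^ (d - 1)"
  by (simp add: t_def t_poly_def)

lemma degree_t_poly: "degree t_poly = d - 1" and lead_coeff_t_poly: "lead_coeff t_poly = int d ^ d"
  using d by (simp_all add: t_poly_def degree_monom_eq)

lemma transcendental_t: "transcendental t"
  unfolding t_def by (rule transcendental_ev[OF c]) (use d in \<open>simp add: degree_t_poly\<close>)

text \<open>
  In the coordinate $y = z/c$ the map is $y \mapsto c^{d-1} y^d + 1$, and the factor $d z^{d-1}$ of
  the multiplier is $d c^{d-1} y^{d-1}$. Both are defined over $\mathbb{Q}(t)$, because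
  $c^{d-1} = t / d^d$. So a power of the multiplier is a polynomial in $y$ over $\mathbb{Q}(t)$, and
  its sum over the periodic points is a combination of power sums of these points. Each cycle is
  counted $m$ times in that sum.
\<close>

lemma cycle_multiplier_power_sum:
  assumes m: "m > 0"
  shows "(\<Sum>C\<in>Cyc m. cycle_multiplier C ^ k) \<in> fractions t"
proof -
  interpret type_subfield "fractions t"
    by (rule type_subfield_fractions[OF transcendental_t])
  define l where "l = inverse c"
  have dK: "(of_nat d :: 'k) \<noteq> 0" using of_nat_nonzero d by simp
  have "c ^ (d - 1) = t * inverse (of_nat d ^ d)"
    using dK by (simp add: t_eq)
  then have cF: "c ^ (d - 1) \<in> fractions t"
    by (simp add: base_point_in_fractions)
  have l: "l \<noteq> 0" "l ^ (d - 1) \<in> fractions t" "l * c \<in> fractions t"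
    using c_nonzero cF by (simp_all add: l_def power_inverse)
  define H where "H = (\<Prod>i<m. smult (of_nat d * c ^ (d - 1)) (scaled_iter l i ^ (d - 1))) ^ k"
  have H: "H \<in> poly_over"
    unfolding H_def
    by (intro power_poly_over prod_poly_over smult_poly_over mult_closed of_nat_closed cF
        scaled_iter_poly_over[OF type_subfield_axioms l])
  have polyH: "poly H (l * z) = poly (pderiv (iter_poly m)) z ^ k" for z
  proof -
    have eq: "of_nat d * c ^ (d - 1) * (l * (f ^^ i) z) ^ (d - 1) = of_nat d * ((f ^^ i) z) ^ (d - 1)" for i
      using c_nonzero by (simp add: l_def power_mult_distrib power_inverse)
    show ?thesis
      unfolding H_def poly_power poly_prod poly_smult poly_scaled_iter[OF l(1)] poly_pderiv_iter_poly eq ..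
  qed
  have "(\<Sum>z\<in>Per m. poly H (l * z)) = (\<Sum>j\<le>degree H. coeff H j * (\<Sum>z\<in>Per m. (l * z) ^ j))"
    unfolding poly_altdef by (subst sum.swap) (simp add: sum_distrib_left)
  also have "\<dots> \<in> fractions t"
    by (intro sum_closed mult_closed coeff_poly_over[OF H]
        power_sum_Per[OF type_subfield_axioms l m])
  finally have sum_in: "(\<Sum>z\<in>Per m. poly (pderiv (iter_poly m)) z ^ k) \<in> fractions t"
    by (simp add: polyH)
  have "(\<Sum>z\<in>Per m. poly (pderiv (iter_poly m)) z ^ k) =
      (\<Sum>C\<in>Cyc m. \<Sum>z\<in>C. poly (pderiv (iter_poly m)) z ^ k)"
    by (rule sum_cycles[OF m])
  also have "\<dots> = (\<Sum>C\<in>Cyc m. of_nat m * cycle_multiplier C ^ k)"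
  proof (rule sum.cong[OF refl])
    fix C assume C: "C \<in> Cyc m"
    have "(\<Sum>z\<in>C. poly (pderiv (iter_poly m)) z ^ k) = (\<Sum>z\<in>C. cycle_multiplier C ^ k)"
      by (rule sum.cong) (simp_all add: multiplier_eq_cycle_multiplier[OF m C])
    then show "(\<Sum>z\<in>C. poly (pderiv (iter_poly m)) z ^ k) = of_nat m * cycle_multiplier C ^ k"
      by (simp add: card_cycles[OF m C])
  qed
  also have "\<dots> = of_nat m * (\<Sum>C\<in>Cyc m. cycle_multiplier C ^ k)"
    by (simp add: sum_distrib_left)
  finally have "(\<Sum>C\<in>Cyc m. cycle_multiplier C ^ k) =
      inverse (of_nat m) * (\<Sum>z\<in>Per m. poly (pderiv (iter_poly m)) z ^ k)"
    using of_nat_nonzero[OF m] by simp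
  also have "\<dots> \<in> fractions t"
    by (intro mult_closed inverse_closed of_nat_closed sum_in)
  finally show ?thesis .
qed

text \<open>
  Choose $r$ with $r^{d-1} = d$ and put $u = r z$, $s = d r c$. The relation $f(z) = z^d + c$ becomes
  $u^d = d u' - s$, where $u'$ belongs to $f(z)$, and $s^d = t s$ since $s^{d-1} = t$. So all of these
  elements are integral over $\mathbb{Z}[t]$. The multiplier $\prod d z^{d-1} = \prod u^{d-1}$ is a
  polynomial in them, and together with the power sums this puts the coefficients into
  $\mathbb{Z}[t]$. The normalisation by $r$ is what absorbs the powers of $d$.
\<close>

lemma mult_poly_integral:
  assumes m: "m > 0"
  obtains D where "map_poly (ev t) D = mult_poly m"
proof (rule ex_map_poly_ev[OF transcendental_t])
  interpret F: type_subfield "fractions t"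
    by (rule type_subfield_fractions[OF transcendental_t])
  have over_F: "mult_poly m \<in> F.poly_over"
    unfolding mult_poly_def
    by (rule F.prod_linear_poly_over[OF of_nat_nonzero finite_Cyc[OF m] cycle_multiplier_power_sum[OF m]])
  obtain r :: 'k where r: "r ^ (d - 1) = of_nat d"
    using nth_root_exists[of "d - 1" "of_nat d :: 'k"] d by auto
  have dd: "x ^ d = x * x ^ (d - 1)" for x :: 'k
    using d by (simp add: power_eq_if)
  have rd: "r ^ d = of_nat d * r"
    by (simp only: dd[of r] r mult.commute)
  define s where "s = of_nat d * r * c"
  define U where "U = insert s ((\<lambda>z. r * z) ` Per m)"
  have "s ^ (d - 1) = t"
    unfolding s_def power_mult_distrib r t_eq dd[of "of_nat d"] by (simp only: mult_ac)
  then have "s ^ d = ev t [:0, 1:] * s"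
    by (simp add: dd[of s] mult.commute)
  then have pow_s: "s ^ d \<in> ev_span t (insert 1 U)"
    by (metis U_def ev_module.span_base ev_module.span_scale insertI1 insertI2)
  have pow_u: "(r * z) ^ d \<in> ev_span t (insert 1 U)" if z: "z \<in> Per m" for z
  proof -
    have "(r * z) ^ d = ev t [:int d:] * (r * f z) - s"
      by (simp add: power_mult_distrib rd f_def s_def algebra_simps)
    also have "\<dots> \<in> ev_span t (insert 1 U)"
      using exact_period_step[OF z m]
      by (intro ev_module.span_diff ev_module.span_scale ev_module.span_base) (auto simp: U_def)
    finally show ?thesis .
  qed
  have pow: "u ^ d \<in> ev_span t (insert 1 U)" if "u \<in> U" for u
    using that pow_s pow_u by (auto simp: U_def)
  have mult_in: "cycle_multiplier C \<in> adjoin t U" if C: "C \<in> Cyc m" for C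
  proof -
    have "C \<subseteq> Per m" using Union_cycles[OF m, of f] C by blast
    moreover have eq: "cycle_multiplier C = (\<Prod>z\<in>C. (r * z) ^ (d - 1))"
      by (simp only: cycle_multiplier_def power_mult_distrib r)
    ultimately show ?thesis
      unfolding eq U_def
      by (intro adjoin.prod_closed adjoin.power_closed adjoin_generator insertI2) blast
  qed
  have over_A: "mult_poly m \<in> type_subring.poly_over (adjoin t U)"
    unfolding mult_poly_def
    by (intro adjoin.prod_poly_over adjoin.pCons_poly_over adjoin.zero_poly_over adjoin.uminus_closed
        adjoin.one_closed mult_in)
  have "finite U" using finite_Per[OF m] by (simp add: U_def)
  then show "coeff (mult_poly m) n \<in> range (ev t)" for n
    using adjoin.coeff_poly_over[OF over_A] F.coeff_poly_over[OF over_F]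
    by (intro integrally_closed[OF transcendental_t _ d pow])
qed

text \<open>
  This is integrality at $t = \infty$, that is, over $\mathbb{Z}[1/t]$. Choose $e$ with
  $e^d = 1/c$. The elements $b = e z$ and $g = z/(d c)$ satisfy $b^d = d g' - 1$ and $g^d = b^d / t$,
  where $g'$ belongs to $f(z)$, so they are integral over $\mathbb{Z}[1/t]$. In terms of the points
  $b$ the multiplier of a cycle is $r \prod b^{d-1}$ with $r^d = t^m$. The coefficient of $x^n$ in the
  product over the $N$ cycles is therefore $r^{N-n}$ times an integral element. Its $d$-th power lies
  in $\mathbb{Q}(t)$ and is $t^{m(N-n)}$ times an element of $\mathbb{Z}[1/t]$, which bounds the degree
  in $t$.
\<close>

lemma degree_coeff_mult_poly:
  assumes m: "m > 0" and D: "map_poly (ev t) D = mult_poly m" and nz: "coeff D n \<noteq> 0"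
  shows "m * n + d * degree (coeff D n) \<le> m * card (Cyc m)"
proof -
  let ?N = "card (Cyc m)"
  define s where "s = inverse t"
  have t0: "t \<noteq> 0" using transcendental_nonzero[OF transcendental_t] .
  have s: "transcendental s" unfolding s_def by (rule transcendental_inverse[OF transcendental_t])
  interpret F: type_subfield "fractions s" by (rule type_subfield_fractions[OF s])
  have "inverse s \<in> fractions s" by (intro F.inverse_closed base_point_in_fractions)
  then have tF: "t \<in> fractions s" by (simp add: s_def)
  have dK: "(of_nat d :: 'k) \<noteq> 0" using of_nat_nonzero d by simp
  obtain e where e: "e ^ d = inverse c"
    using nth_root_exists[of d "inverse c"] d by auto
  have e0: "e \<noteq> 0" using e c_nonzero d by (auto simp: power_0_left)
  define g where "g z = z / (of_nat d * c)" for z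
  define U where "U = (\<lambda>z. e * z) ` Per m \<union> g ` Per m"
  have pow_e: "(e * z) ^ d \<in> ev_span s (insert 1 U)" if z: "z \<in> Per m" for z
  proof -
    have "(e * z) ^ d = ev s [:int d:] * g (f z) - 1"
      using dK c_nonzero by (simp add: power_mult_distrib e g_def f_def field_simps)
    also have "\<dots> \<in> ev_span s (insert 1 U)"
      using exact_period_step[OF z m]
      by (intro ev_module.span_diff ev_module.span_scale ev_module.span_base) (auto simp: U_def)
    finally show ?thesis .
  qed
  have pow_g: "g z ^ d \<in> ev_span s (insert 1 U)" if z: "z \<in> Per m" for z
  proof -
    have cd: "c ^ d = c * c ^ (d - 1)" using d by (simp add: power_eq_if)
    have "g z ^ d = ev s [:0, 1:] * (e * z) ^ d"
      using c_nonzero by (simp add: g_def power_divide power_mult_distrib e s_def t_eq cd field_simps)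
    also have "\<dots> \<in> ev_span s (insert 1 U)"
      by (intro ev_module.span_scale pow_e z)
    finally show ?thesis .
  qed
  have pow: "u ^ d \<in> ev_span s (insert 1 U)" if "u \<in> U" for u
    using that pow_e pow_g by (auto simp: U_def)
  define r where "r = (of_nat d / e ^ (d - 1)) ^ m"
  have "(of_nat d / e ^ (d - 1)) ^ d = t"
    unfolding t_eq power_divide power_mult[symmetric] mult.commute[of "d - 1"] power_mult e
    by (simp add: power_inverse divide_inverse)
  then have rd: "r ^ d = t ^ m"
    unfolding r_def by (metis power_mult mult.commute)
  define b where "b C = (\<Prod>z\<in>C. (e * z) ^ (d - 1))" for C
  have b_in: "b C \<in> adjoin s U" if C: "C \<in> Cyc m" for C
  proof -
    have "C \<subseteq> Per m" using Union_cycles[OF m, of f] C by blast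
    then show ?thesis
      unfolding b_def U_def
      by (intro adjoin.prod_closed adjoin.power_closed adjoin_generator UnI1) blast
  qed
  have mult_b: "cycle_multiplier C = r * b C" if C: "C \<in> Cyc m" for C
  proof -
    have "r * b C = (\<Prod>z\<in>C. of_nat d / e ^ (d - 1) * (e * z) ^ (d - 1))"
      unfolding prod.distrib b_def prod_constant r_def card_cycles[OF m C] ..
    then show ?thesis
      using e0 by (simp add: cycle_multiplier_def power_mult_distrib)
  qed
  define B where "B = (\<Prod>C\<in>Cyc m. [:- b C, 1:])"
  define x where "x = coeff B n ^ d"
  have "mult_poly m = (\<Prod>C\<in>Cyc m. [:- (r * b C), 1:])"
    unfolding mult_poly_def by (rule prod.cong) (simp_all add: mult_b)
  then have "r ^ n * coeff (mult_poly m) n = r ^ ?N * coeff B n"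
    unfolding B_def by (simp only: coeff_prod_linear_scaled)
  moreover have "coeff (mult_poly m) n = ev t (coeff D n)"
    by (simp add: D[symmetric] coeff_map_poly)
  ultimately have "(r ^ n * ev t (coeff D n)) ^ d = (r ^ ?N * coeff B n) ^ d"
    by simp
  moreover have "(r ^ k) ^ d = t ^ (m * k)" for k
    by (metis rd power_mult mult.commute)
  ultimately have eq: "t ^ (m * n) * ev t (coeff D n) ^ d = t ^ (m * ?N) * x"
    by (simp add: x_def power_mult_distrib)
  have "B \<in> type_subring.poly_over (adjoin s U)"
    unfolding B_def
    by (intro adjoin.prod_poly_over adjoin.pCons_poly_over adjoin.zero_poly_over adjoin.uminus_closed
        adjoin.one_closed b_in)
  then have "x \<in> adjoin s U"
    unfolding x_def by (intro adjoin.power_closed adjoin.coeff_poly_over)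
  moreover have "x = inverse (t ^ (m * ?N)) * (t ^ (m * n) * ev t (coeff D n) ^ d)"
    using t0 by (simp add: eq)
  then have "x \<in> fractions s"
    by (simp add: tF F.ev_closed)
  moreover have "finite U" using finite_Per[OF m] by (simp add: U_def)
  ultimately have "x \<in> range (ev s)"
    by (intro integrally_closed[OF s _ d pow])
  then obtain q where q: "x = ev s q" by blast
  have "ev t (reflect_poly q) = t ^ degree q * x"
    unfolding q s_def by (rule ev_reflect_poly[OF transcendental_t])
  then have "t ^ degree q * (t ^ (m * n) * ev t (coeff D n) ^ d) = t ^ (m * ?N) * ev t (reflect_poly q)"
    unfolding eq by (simp add: mult_ac)
  then have "ev t (Polynomial.monom 1 (degree q + m * n) * coeff D n ^ d) =
      ev t (Polynomial.monom 1 (m * ?N) * reflect_poly q)"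
    by (simp add: power_add mult.assoc)
  then have poly_eq: "Polynomial.monom 1 (degree q + m * n) * coeff D n ^ d =
      Polynomial.monom 1 (m * ?N) * reflect_poly q"
    using transcendental_ev_eq_iff[OF transcendental_t] by blast
  have mon: "Polynomial.monom (1 :: int) k \<noteq> 0" "degree (Polynomial.monom (1 :: int) k) = k" for k
    by (simp_all add: monom_eq_0_iff degree_monom_eq)
  have "degree q + m * n + d * degree (coeff D n) =
      degree (Polynomial.monom 1 (degree q + m * n) * coeff D n ^ d)"
    using nz by (subst degree_mult_eq) (auto simp: mon degree_power_eq)
  also have "\<dots> \<le> m * ?N + degree (reflect_poly q)"
    unfolding poly_eq using degree_mult_le[of "Polynomial.monom 1 (m * ?N)" "reflect_poly q"]
    by (simp add: mon)
  also have "\<dots> \<le> m * ?N + degree q"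
    using degree_reflect_poly_le by simp
  finally show ?thesis by simp
qed

section \<open>The constant coefficient of the multiplier polynomial\<close>

text \<open>
  The dynatomic polynomial, characterised by its image over the algebraically closed field.
\<close>

definition Phi :: "nat \<Rightarrow> int poly poly" where
  "Phi m = (SOME \<Phi>. map_poly (ev c) \<Phi> = period_poly m)"

lemma map_poly_Phi: "m > 0 \<Longrightarrow> map_poly (ev c) (Phi m) = period_poly m"
  unfolding Phi_def by (rule someI_ex) (use period_poly_integral in blast)

lemma prod_Phi:
  assumes m: "m > 0"
  shows "(\<Prod>k | k dvd m. Phi k) = iterate d m - [:0, 1:]"
proof -
  have "map_poly (ev c) (\<Prod>k | k dvd m. Phi k) = (\<Prod>k | k dvd m. period_poly k)"
    unfolding map_poly_ev_prod
    using m by (intro prod.cong refl map_poly_Phi) (auto intro: dvd_pos_nat)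
  also have "\<dots> = iter_poly m - [:0, 1:]"
    unfolding period_poly_def fixed_poly_eq_prod(1)[OF m] prod_fixed_points[OF m fixed_poly_eq_prod(2)[OF m]] ..
  also have "\<dots> = map_poly (ev c) (iterate d m - [:0, 1:])"
    by (simp add: iter_poly_def map_poly_ev_diff map_poly_pCons)
  finally show ?thesis
    using map_poly_ev_eq_iff[OF c] by blast
qed

text \<open>
  The critical orbit $0 \mapsto c \mapsto c^d + c \mapsto \cdots$ consists of monic polynomials in $c$.
\<close>

lemma critical_orbit_monic:
  "degree (coeff (iterate d (Suc k)) 0) = d ^ k \<and> lead_coeff (coeff (iterate d (Suc k)) 0) = 1"
proof (induction k)
  case 0
  then show ?case
    using d by (simp add: iterate_Suc iterate_0 coeff_0_power power_0_left)
next
  case (Suc k)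
  let ?a = "coeff (iterate d (Suc k)) 0"
  have a: "coeff (iterate d (Suc (Suc k))) 0 = ?a ^ d + [:0, 1:]"
    unfolding iterate_Suc[of d "Suc k"] by (simp add: coeff_0_power)
  have IH: "degree ?a = d ^ k" "lead_coeff ?a = 1"
    using Suc by blast+
  then have "?a \<noteq> 0" by auto
  then have deg: "degree (?a ^ d) = d ^ Suc k"
    by (simp add: degree_power_eq IH(1))
  have lead: "lead_coeff (?a ^ d) = 1"
    unfolding lead_coeff_power IH(2) by simp
  have "1 < d ^ Suc k" using d by (intro one_less_power) auto
  then have "degree [:0, 1 :: int:] < degree (?a ^ d)"
    unfolding deg by simp
  then show ?case
    unfolding a using deg lead by (metis add.commute degree_add_eq_left lead_coeff_add_le)
qed

text \<open>
  At $z = 0$ the factorisation $f^{\circ m}(z) - z = \prod_{k \mid m} \Phi_k(z)$ gives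
  $f^{\circ m}(0) = \prod_{k \mid m} \Phi_k(0)$, and $f^{\circ m}(0)$ is monic of degree $d^{m-1}$ in
  $c$. Induction on $m$, in parallel with the count $d^m$ of the points of period $m$.
\<close>

lemma Phi_at_0:
  assumes "m > 0"
  shows "lead_coeff (coeff (Phi m) 0) = 1 \<and> d * degree (coeff (Phi m) 0) = card (Per m)"
  using assms
proof (induction m rule: less_induct)
  case (less m)
  let ?a = "\<lambda>k. coeff (Phi k) 0"
  let ?K = "{k. k dvd m \<and> k < m}"
  have div: "{k. k dvd m} = insert m ?K"
    using less.prems by (auto dest: dvd_imp_le)
  have fin: "finite ?K" and notin: "m \<notin> ?K" by auto
  have IH: "lead_coeff (?a k) = 1" "d * degree (?a k) = card (Per k)" if "k \<in> ?K" for k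
    using less.IH[of k] that less.prems by (auto intro: dvd_pos_nat)
  obtain n where n: "m = Suc n" using less.prems by (cases m) auto
  define Q where "Q = (\<Prod>k\<in>?K. ?a k)"
  have "(\<Prod>k | k dvd m. ?a k) = coeff (\<Prod>k | k dvd m. Phi k) 0"
    by (simp add: poly_prod flip: poly_0_coeff_0)
  also have "\<dots> = coeff (iterate d m) 0"
    unfolding prod_Phi[OF less.prems] by simp
  finally have prod_eq: "?a m * Q = coeff (iterate d (Suc n)) 0"
    unfolding div Q_def n[symmetric] using fin notin by simp
  have leadQ: "lead_coeff Q = 1"
    unfolding Q_def lead_coeff_prod by (intro prod.neutral ballI IH(1))
  have lead: "lead_coeff (?a m) = 1"
    using arg_cong[OF prod_eq, of lead_coeff] conjunct2[OF critical_orbit_monic[of n]]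
    unfolding lead_coeff_mult leadQ mult_1_right by (rule trans)
  have nz: "?a k \<noteq> 0" if "k \<in> ?K" for k
    using IH(1)[OF that] by auto
  have degQ: "d * degree Q = (\<Sum>k\<in>?K. card (Per k))"
  proof -
    have "degree Q = (\<Sum>k\<in>?K. degree (?a k))"
      unfolding Q_def using nz by (intro degree_prod_eq_sum_degree) auto
    then show ?thesis using IH(2) by (simp add: sum_distrib_left)
  qed
  have "degree (?a m * Q) = degree (?a m) + degree Q"
    using lead leadQ by (intro degree_mult_eq) auto
  then have "degree (?a m) + degree Q = d ^ n"
    unfolding prod_eq using critical_orbit_monic[of n] by simp
  then have "d * degree (?a m) + d * degree Q = d ^ m"
    by (simp add: n flip: distrib_left)
  moreover have "d ^ m = card (Per m) + (\<Sum>k\<in>?K. card (Per k))"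
  proof -
    have "d ^ m = (\<Sum>k | k dvd m. card (Per k))"
      using sum_fixed_points[OF less.prems fixed_poly_eq_prod(2)[OF less.prems], where h = "\<lambda>_. 1 :: nat"]
      by (simp add: card_Fix[OF less.prems])
    then show ?thesis unfolding div using fin notin by simp
  qed
  ultimately show ?case using lead degQ by simp
qed

text \<open>
  Up to the sign, the constant coefficient is the product of all multipliers. That is
  $d^{d_m} \Phi_m(0)^{d-1}$, with $\Phi_m(0)$ monic of degree $d_m / d$ in $c$, so it has the leading
  term $d^{d_m} c^{(d-1) d_m / d} = t^{d_m / d}$.
\<close>

lemma constant_coeff_mult_poly:
  assumes m: "m > 0" and D: "map_poly (ev t) D = mult_poly m"
  shows "lead_coeff (coeff D 0) = (-1) ^ card (Cyc m) \<and> d * degree (coeff D 0) = card (Per m)"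
proof -
  let ?N = "card (Cyc m)" and ?p = "coeff D 0" and ?a = "coeff (Phi m) 0"
  have a: "lead_coeff ?a = 1" "d * degree ?a = card (Per m)"
    using Phi_at_0[OF m] by auto
  have a0: "?a \<noteq> 0" using a(1) by auto
  \<comment> \<open>The sign $(-1)^{d_m (d-1)}$ is trivial since $d \mid d_m$.\<close>
  have "even (card (Per m) * (d - 1))"
    unfolding a(2)[symmetric] by (cases "even d") auto
  then have sign: "((- 1) ^ card (Per m)) ^ (d - 1) = (1 :: 'k)"
    by (simp flip: power_mult)
  have "ev c ?a = coeff (period_poly m) 0"
    by (simp add: map_poly_Phi[OF m, symmetric] coeff_map_poly)
  also have "\<dots> = (\<Prod>z\<in>Per m. - z)"
    by (simp add: period_poly_def poly_prod flip: poly_0_coeff_0)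
  finally have eva: "ev c ?a ^ (d - 1) = (\<Prod>z\<in>Per m. z) ^ (d - 1)"
    by (simp only: prod_uminus power_mult_distrib sign mult_1_left)
  have "ev c (pcompose ?p t_poly) = coeff (mult_poly m) 0"
    by (simp add: D[symmetric] coeff_map_poly t_def)
  also have "\<dots> = (\<Prod>C\<in>Cyc m. - cycle_multiplier C)"
    by (simp add: mult_poly_def poly_prod flip: poly_0_coeff_0)
  also have "\<dots> = (-1) ^ ?N * (of_nat d ^ card (Per m) * ev c ?a ^ (d - 1))"
    by (simp only: prod_uminus prod_cycle_multiplier[OF m] eva)
  also have "\<dots> = ev c (smult ((-1) ^ ?N * int d ^ card (Per m)) (?a ^ (d - 1)))"
    by (simp add: mult.assoc)
  finally have eq: "pcompose ?p t_poly = smult ((-1) ^ ?N * int d ^ card (Per m)) (?a ^ (d - 1))"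
    using transcendental_ev_eq_iff[OF c] by blast
  have "degree ?p * (d - 1) = degree (pcompose ?p t_poly)"
    by (simp add: degree_pcompose degree_t_poly)
  also have "\<dots> = (d - 1) * degree ?a"
    unfolding eq using d by (simp add: degree_power_eq[OF a0])
  finally have deg: "degree ?p = degree ?a"
    using d by simp
  have "lead_coeff ?p * (int d ^ d) ^ degree ?p = lead_coeff (pcompose ?p t_poly)"
    using d lead_coeff_comp[of t_poly ?p] unfolding lead_coeff_t_poly by (simp add: degree_t_poly)
  also have "\<dots> = (-1) ^ ?N * int d ^ card (Per m)"
    unfolding eq lead_coeff_smult lead_coeff_power a(1) by simp
  also have "int d ^ card (Per m) = (int d ^ d) ^ degree ?p"
    unfolding deg a(2)[symmetric] power_mult ..
  finally have "lead_coeff ?p = (-1) ^ ?N"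
    using d by simp
  then show ?thesis using deg a(2) by simp
qed

end

section \<open>Moebius inversion\<close>

lemma moebius_mu_1: "moebius_mu 1 = 1"
  by (simp add: moebius_mu_def)

lemma moebius_mu_prime_mult:
  assumes p: "prime p" and k: "\<not> p dvd k"
  shows "moebius_mu (p * k) = - moebius_mu k"
proof -
  have k0: "k \<noteq> 0" using k by (metis dvd_0_right)
  have "coprime p k" using p k by (rule prime_imp_coprime)
  then have "squarefree (p * k) \<longleftrightarrow> squarefree k"
    using squarefree_mult_coprime[of p k] squarefree_prime[OF p] squarefree_multD(2)[of p k] by blast
  moreover have "prime_factors (p * k) = insert p (prime_factors k)"
    using p k0 by (simp add: prime_factors_product prime_prime_factors)
  moreover have "p \<notin> prime_factors k"
    using k by (auto dest: in_prime_factors_imp_dvd)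
  ultimately show ?thesis
    by (simp add: moebius_mu_def)
qed

text \<open>
  For a prime $p \mid n$, the map $k \mapsto p k$ sends the divisors not divisible by $p$ to divisors
  with the opposite value of the Moebius function, and it reaches all divisors that are divisible by
  $p$ but not by $p^2$. The remaining divisors contribute $0$.
\<close>

lemma sum_moebius_mu:
  assumes n: "n > 0"
  shows "(\<Sum>k | k dvd n. moebius_mu k) = (if n = 1 then 1 else 0)"
proof (cases "n = 1")
  case True
  then show ?thesis using moebius_mu_1 by simp
next
  case False
  then obtain p where p: "prime p" "p dvd n"
    using prime_factor_nat by blast
  define A where "A = {k. k dvd n \<and> \<not> p dvd k}"
  define B where "B = {k. k dvd n \<and> p dvd k}"
  have fin: "finite A" "finite B" using n by (simp_all add: A_def B_def)
  have "(\<Sum>k\<in>B. moebius_mu k) = (\<Sum>k\<in>(\<lambda>k. p * k) ` A. moebius_mu k)"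
  proof (rule sum.mono_neutral_right)
    show "(\<lambda>k. p * k) ` A \<subseteq> B"
      using p by (auto simp: A_def B_def intro!: divides_mult prime_imp_coprime)
    show "\<forall>k\<in>B - (\<lambda>k. p * k) ` A. moebius_mu k = 0"
    proof
      fix k assume k: "k \<in> B - (\<lambda>k. p * k) ` A"
      then obtain j where j: "k = p * j" by (auto simp: B_def)
      have "j dvd n" using k j dvd_mult_right by (auto simp: B_def)
      then have "p dvd j" using k j by (auto simp: A_def)
      then have "p ^ 2 dvd k" using j by (simp add: power2_eq_square)
      then have "\<not> squarefree k"
        using p(1) by (intro not_squarefreeI) (auto simp: prime_nat_iff)
      then show "moebius_mu k = 0" by (simp add: moebius_mu_def)
    qed
  qed (use fin in auto)
  also have "\<dots> = (\<Sum>k\<in>A. moebius_mu (p * k))"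
    using p(1) by (subst sum.reindex) (auto simp: inj_on_def prime_gt_0_nat)
  also have "\<dots> = - (\<Sum>k\<in>A. moebius_mu k)"
    using moebius_mu_prime_mult[OF p(1)] by (simp add: A_def sum_negf[symmetric])
  finally have "(\<Sum>k\<in>A. moebius_mu k) + (\<Sum>k\<in>B. moebius_mu k) = 0" by simp
  moreover have "{k. k dvd n} = A \<union> B" "A \<inter> B = {}"
    by (auto simp: A_def B_def)
  ultimately show ?thesis
    using False fin by (simp add: sum.union_disjoint)
qed

lemma sum_moebius_mu_between:
  assumes m: "m > 0" and j: "j dvd m"
  shows "(\<Sum>k | k dvd m \<and> j dvd k. moebius_mu (m div k)) = (if j = m then 1 else 0)"
proof -
  obtain e where e: "m = j * e" using j by blast
  have "(\<Sum>k | k dvd m \<and> j dvd k. moebius_mu (m div k)) = (\<Sum>i | i dvd e. moebius_mu i)"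
  proof (rule sum.reindex_bij_witness[of _ "\<lambda>i. m div i" "\<lambda>k. m div k"])
    fix k assume k: "k \<in> {k. k dvd m \<and> j dvd k}"
    then obtain a b where ab: "k = j * a" "m = k * b" by (auto elim!: dvdE)
    show "m div (m div k) = k" using ab m by simp
    show "m div k \<in> {i. i dvd e}" using ab m e by auto
  next
    fix i assume i: "i \<in> {i. i dvd e}"
    then obtain a where a: "e = i * a" by auto
    show "m div (m div i) = i" using a m e by simp
    show "m div i \<in> {k. k dvd m \<and> j dvd k}" using a m e by auto
  qed simp
  also have "\<dots> = (if j = m then 1 else 0)"
    using m e by (subst sum_moebius_mu) auto
  finally show ?thesis .
qed

lemma moebius_inversion_sum:
  assumes m: "m > 0"
  shows "(\<Sum>k | k dvd m. (\<Sum>j | j dvd k. g j) * moebius_mu (m div k)) = g m"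
proof -
  let ?S = "{k. k dvd m}"
  have fin: "finite ?S" using m by simp
  have "(\<Sum>k\<in>?S. (\<Sum>j | j dvd k. g j) * moebius_mu (m div k)) =
      (\<Sum>k\<in>?S. \<Sum>j | j \<in> ?S \<and> j dvd k. g j * moebius_mu (m div k))"
    unfolding sum_distrib_right
    by (intro sum.cong refl) (auto intro: dvd_trans)
  also have "\<dots> = (\<Sum>j\<in>?S. \<Sum>k | k \<in> ?S \<and> j dvd k. g j * moebius_mu (m div k))"
    using fin fin by (rule sum.swap_restrict)
  also have "\<dots> = (\<Sum>j\<in>?S. if j = m then g j else 0)"
    using sum_moebius_mu_between[OF m]
    by (intro sum.cong refl) (simp flip: sum_distrib_left)
  finally show ?thesis using fin by simp
qed

lemma moebius_inversion_prod:
  fixes g :: "nat \<Rightarrow> 'a::field"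
  assumes m: "m > 0" and nz: "\<And>j. j dvd m \<Longrightarrow> g j \<noteq> 0"
  shows "(\<Prod>k | k dvd m. (\<Prod>j | j dvd k. g j) powi moebius_mu (m div k)) = g m"
proof -
  let ?S = "{k. k dvd m}"
  have fin: "finite ?S" using m by simp
  have powi_prod: "(\<Prod>j\<in>A. g j) powi e = (\<Prod>j\<in>A. g j powi e)" for A e
    by (induction A rule: infinite_finite_induct) (simp_all add: power_int_mult_distrib)
  have powi_sum: "(\<Prod>k\<in>A. g j powi e k) = g j powi (\<Sum>k\<in>A. e k)" if "j dvd m" for A j and e :: "nat \<Rightarrow> int"
    by (induction A rule: infinite_finite_induct) (simp_all add: power_int_add nz[OF that])
  have "(\<Prod>k\<in>?S. (\<Prod>j | j dvd k. g j) powi moebius_mu (m div k)) =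
      (\<Prod>k\<in>?S. \<Prod>j | j \<in> ?S \<and> j dvd k. g j powi moebius_mu (m div k))"
    unfolding powi_prod
    by (intro prod.cong refl) (auto intro: dvd_trans)
  also have "\<dots> = (\<Prod>j\<in>?S. \<Prod>k | k \<in> ?S \<and> j dvd k. g j powi moebius_mu (m div k))"
    using fin fin by (rule prod.swap_restrict)
  also have "\<dots> = (\<Prod>j\<in>?S. if j = m then g j else 1)"
    using sum_moebius_mu_between[OF m]
    by (intro prod.cong refl) (simp add: powi_sum)
  finally show ?thesis using fin by simp
qed

section \<open>The multiplier polynomial in the variable $t$\<close>

text \<open>
  Exchange of the two variables: the same element of $\mathbb{Z}[t][x]$, now with $t$ as the outer
  variable, as \<^const>\<open>eval_t\<close> expects it.
\<close>

definition swap_poly :: "int poly poly \<Rightarrow> int poly poly" where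
  "swap_poly D = (\<Sum>n\<le>degree D. map_poly (\<lambda>a. Polynomial.monom a n) (coeff D n))"

lemma coeff_swap_poly: "coeff (coeff (swap_poly D) k) n = coeff (coeff D n) k"
proof -
  have "coeff (coeff (swap_poly D) k) n = (\<Sum>i\<le>degree D. if i = n then coeff (coeff D i) k else 0)"
    by (simp add: swap_poly_def coeff_sum coeff_map_poly)
  also have "\<dots> = coeff (coeff D n) k"
    by (simp add: coeff_eq_0)
  finally show ?thesis .
qed

lemma eval_t_0: "eval_t d 0 = 0"
  by (simp add: eval_t_def)

lemma eval_t_pCons:
  "eval_t d (pCons g G) =
    map_poly (\<lambda>a. [:a:]) g + [:Polynomial.monom (int d ^ d) (d - 1):] * eval_t d G"
  by (simp add: eval_t_def map_poly_pCons)

lemma eval_t_add: "eval_t d (G + H) = eval_t d G + eval_t d H"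
proof -
  have const: "map_poly (\<lambda>a. [:a:]) (p + q) = map_poly (\<lambda>a. [:a:]) p + map_poly (\<lambda>a. [:a:]) q"
    for p q :: "int poly"
    by (rule poly_eqI) (simp add: coeff_map_poly)
  have "map_poly (map_poly (\<lambda>a. [:a:])) (G + H) =
      map_poly (map_poly (\<lambda>a. [:a:])) G + map_poly (map_poly (\<lambda>a. [:a:])) H"
    by (rule poly_eqI) (simp add: coeff_map_poly const)
  then show ?thesis by (simp add: eval_t_def)
qed

lemma eval_t_sum: "eval_t d (\<Sum>i\<in>A. h i) = (\<Sum>i\<in>A. eval_t d (h i))"
  by (induction A rule: infinite_finite_induct) (simp_all add: eval_t_0 eval_t_add)

lemma eval_t_monom:
  "eval_t d (map_poly (\<lambda>a. Polynomial.monom a n) p) =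
    Polynomial.monom (pcompose p (Polynomial.monom (int d ^ d) (d - 1))) n"
proof (induction p)
  case 0
  then show ?case by (simp add: eval_t_0)
next
  case (pCons a p)
  have "map_poly (\<lambda>a. [:a:]) (Polynomial.monom a n) = Polynomial.monom [:a:] n" for a :: int
    by (rule poly_eqI) (simp add: coeff_map_poly)
  then show ?case
    by (simp add: map_poly_pCons eval_t_pCons pCons.IH pcompose_pCons smult_monom add_monom)
qed

lemma coeff_eval_t_swap_poly:
  "coeff (eval_t d (swap_poly D)) n = pcompose (coeff D n) (Polynomial.monom (int d ^ d) (d - 1))"
proof -
  have "coeff (eval_t d (swap_poly D)) n =
      (\<Sum>i\<le>degree D. if i = n then pcompose (coeff D i) (Polynomial.monom (int d ^ d) (d - 1)) else 0)"
    by (simp add: swap_poly_def eval_t_sum eval_t_monom coeff_sum)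
  also have "\<dots> = pcompose (coeff D n) (Polynomial.monom (int d ^ d) (d - 1))"
    by (simp add: coeff_eq_0)
  finally show ?thesis .
qed

context unicritical
begin

text \<open>
  By the degree bound the constant coefficient of $\delta_m$ has a greater degree in $t$ than all
  other coefficients, so it alone contributes to the highest power of $t$.
\<close>

lemma lead_coeff_swap_mult_poly:
  assumes m: "m > 0" and D: "map_poly (ev t) D = mult_poly m"
  shows "lead_coeff (swap_poly D) = (-1) ^ card (Cyc m)"
proof -
  let ?e = "degree (coeff D 0)"
  have lead: "lead_coeff (coeff D 0) = (-1) ^ card (Cyc m)" and e: "d * ?e = m * card (Cyc m)"
    using constant_coeff_mult_poly[OF m D] card_exact_period[OF m, of f] by auto
  have small: "coeff (coeff D n) k = 0" if "n > 0" "k \<ge> ?e" for n k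
  proof (cases "coeff D n = 0")
    case False
    have "m * n + d * degree (coeff D n) \<le> d * ?e"
      using degree_coeff_mult_poly[OF m D False] e by simp
    then have "d * degree (coeff D n) < d * ?e"
      using m that(1) by (metis add_gr_0 less_add_same_cancel2 nat_0_less_mult_iff order_less_le_trans)
    then show ?thesis using that(2) by (intro coeff_eq_0) simp
  qed simp
  \<comment> \<open>The constant coefficient in $x$ is the only one that reaches the degree ?e in $t$.\<close>
  have top: "coeff (swap_poly D) ?e = [:lead_coeff (coeff D 0):]"
    by (rule poly_eqI) (simp add: coeff_swap_poly small coeff_pCons split: nat.split)
  have "coeff (swap_poly D) k = 0" if "k > ?e" for k
  proof (rule poly_eqI)
    show "coeff (coeff (swap_poly D) k) n = coeff 0 n" for n
      using that small[of n k] by (cases "n = 0") (simp_all add: coeff_swap_poly coeff_eq_0)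
  qed
  then have "degree (swap_poly D) \<le> ?e"
    by (intro degree_le) auto
  moreover have "coeff (swap_poly D) ?e \<noteq> 0"
    unfolding top lead by simp
  ultimately have "degree (swap_poly D) = ?e"
    using le_degree by (intro antisym)
  then have "lead_coeff (swap_poly D) = [:(-1) ^ card (Cyc m):]"
    using top lead by simp
  moreover have "[:- 1 :: int:] = - 1"
    by (simp add: one_pCons)
  moreover have "[:(- 1 :: int) ^ k:] = [:- 1:] ^ k" for k
  proof (induction k)
    case (Suc k)
    have "[:(- 1 :: int) ^ Suc k:] = [:- 1:] * [:(- 1) ^ k:]" by simp
    then show ?case by (simp only: Suc power_Suc)
  qed (simp add: one_pCons)
  ultimately show ?thesis
    by (simp only:)
qed

section \<open>Comparison with the dynatomic polynomial and the multiplier polynomial over $\mathbb{Z}[c]$\<close>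

text \<open>
  Moebius inversion of the count $d^k = \sum_{j \mid k} |\mathrm{Per}_j|$ of the points of period $k$.
\<close>

lemma dyn_degree_eq:
  assumes m: "m > 0"
  shows "dyn_degree d m = int m * int (card (Cyc m))"
proof -
  have "int d ^ k = (\<Sum>j | j dvd k. int (card (Per j)))" if "k dvd m" for k
  proof -
    have k: "k > 0" using that m by (rule dvd_pos_nat[rotated])
    have "d ^ k = (\<Sum>j | j dvd k. card (Per j))"
      using sum_fixed_points[OF k fixed_poly_eq_prod(2)[OF k], where h = "\<lambda>_. 1 :: nat"]
      by (simp add: card_Fix[OF k])
    then have "int (d ^ k) = int (\<Sum>j | j dvd k. card (Per j))" by (rule arg_cong)
    then show ?thesis by simp
  qed
  then have "dyn_degree d m = (\<Sum>k | k dvd m. (\<Sum>j | j dvd k. int (card (Per j))) * moebius_mu (m div k))"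
    unfolding dyn_degree_def by (intro sum.cong refl) simp
  also have "\<dots> = int (card (Per m))"
    by (rule moebius_inversion_sum[OF m])
  finally show ?thesis by (simp add: card_exact_period[OF m])
qed

lemma dynatomic_eq_Phi:
  assumes m: "m > 0"
  shows "dynatomic d m = Phi m"
proof -
  have pos: "k > 0" if "k dvd m" for k
    using that m by (rule dvd_pos_nat[rotated])
  have to_fract_prod: "to_fract (\<Prod>j\<in>A. Phi j) = (\<Prod>j\<in>A. to_fract (Phi j))" for A
    by (induction A rule: infinite_finite_induct) simp_all
  have "Phi j \<noteq> 0" if "j dvd m" for j
    using Phi_at_0[OF pos[OF that]] by auto
  then have "(\<Prod>k | k dvd m. (\<Prod>j | j dvd k. to_fract (Phi j)) powi moebius_mu (m div k)) = to_fract (Phi m)"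
    by (intro moebius_inversion_prod[OF m]) simp
  moreover have "(\<Prod>k | k dvd m. (\<Prod>j | j dvd k. to_fract (Phi j)) powi moebius_mu (m div k)) =
      (\<Prod>k | k dvd m. to_fract (iterate d k - [:0, 1:]) powi moebius_mu (m div k))"
    by (intro prod.cong refl) (simp add: prod_Phi[OF pos] flip: to_fract_prod)
  ultimately show ?thesis
    unfolding dynatomic_def by (intro the_equality) auto
qed

lemma proots_period_poly:
  assumes "m > 0"
  shows "proots (period_poly m) = mset_set (Per m)"
  by (simp add: period_poly_def prod_unfold_prod_mset proots_prod_linear)

end

text \<open>
  In $p^m - q^m = (p - q) \sum_i q^{m-1-i} p^i$ the sum has leading coefficient $m \neq 0$.
\<close>

lemma monic_power_eq_imp_eq:
  fixes p q :: "'a::{idom, ring_char_0} poly"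
  assumes p: "lead_coeff p = 1" and q: "lead_coeff q = 1" and m: "m > 0" and eq: "p ^ m = q ^ m"
  shows "p = q"
proof -
  have nz: "p \<noteq> 0" "q \<noteq> 0" using p q by auto
  have "m * degree p = m * degree q"
    using arg_cong[OF eq, of degree] nz by (simp add: degree_power_eq)
  then have deg: "degree p = degree q" using m by simp
  define n where "n = degree q"
  define S where "S = (\<Sum>i<m. q ^ (m - Suc i) * p ^ i)"
  have "coeff (q ^ (m - Suc i) * p ^ i) ((m - 1) * n) = 1" if i: "i < m" for i
  proof -
    have "m - 1 = (m - Suc i) + i" using i by simp
    then have "(m - 1) * n = degree (q ^ (m - Suc i)) + degree (p ^ i)"
      using nz by (simp add: degree_power_eq deg n_def distrib_right)
    then have "coeff (q ^ (m - Suc i) * p ^ i) ((m - 1) * n) =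
        lead_coeff (q ^ (m - Suc i)) * lead_coeff (p ^ i)"
      using coeff_mult_degree_sum[of "q ^ (m - Suc i)" "p ^ i"] by simp
    then show ?thesis
      by (simp only: lead_coeff_power p q power_one mult_1_right)
  qed
  then have "coeff S ((m - 1) * n) = of_nat m"
    by (simp add: S_def coeff_sum)
  then have "S \<noteq> 0" using m by auto
  have "(p - q) * S = p ^ m - q ^ m"
    unfolding S_def by (rule power_diff_sumr2[symmetric])
  then show ?thesis using eq \<open>S \<noteq> 0\<close> by simp
qed

text \<open>
  Ring homomorphisms on $\mathbb{Z}[c]$ are determined by the image of $c$, so the results for an
  abstract transcendental element apply to the given field.
\<close>

lemma base_emb_eq_ev: "base_emb = ev (base_emb [:0, 1:])"
proof
  fix p show "base_emb p = ev (base_emb [:0, 1:]) p"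
  proof (induction p)
    case 0
    then show ?case by (simp add: base_emb_def)
  next
    case (pCons a p)
    have to_fract_of_nat: "to_fract (of_nat n :: int poly) = of_nat n" for n
      by (induction n) simp_all
    have "to_fract (of_int a :: int poly) = of_int a"
      by (cases a) (simp_all add: to_fract_of_nat del: of_nat_Suc)
    moreover have "[:a:] = of_int a"
      by (simp add: of_int_poly)
    ultimately have const: "base_emb [:a:] = of_int a"
      by (simp only: base_emb_def to_ac_of_int)
    have "pCons a p = [:a:] + [:0, 1:] * p" by simp
    then have "base_emb (pCons a p) = base_emb [:a:] + base_emb [:0, 1:] * base_emb p"
      unfolding base_emb_def by (simp only: to_fract_add to_fract_mult to_ac_add to_ac_mult)
    then show ?case by (simp add: const pCons.IH)
  qed
qed

lemma transcendental_base_emb: "transcendental (base_emb [:0, 1:])"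
  unfolding transcendental_def base_emb_eq_ev[symmetric] by (simp add: base_emb_def)

theorem theorem1p2:
  fixes d m :: nat
  assumes "d \<ge> 2" and "m \<ge> 1"
  shows "\<exists>G :: int poly poly.
           multiplier_poly d m = eval_t d G \<and>
           lead_coeff ((-1) ^ nat (dyn_degree d m div int m) * G) = 1"
proof -
  obtain c where emb: "base_emb = ev c" and c: "transcendental c"
    using base_emb_eq_ev transcendental_base_emb by blast
  interpret unicritical c d
    by unfold_locales (simp_all add: assms(1) c)
  have m: "m > 0" using assms(2) by simp
  obtain D where D: "map_poly (ev t) D = mult_poly m"
    using mult_poly_integral[OF m] by blast
  define G where "G = swap_poly D"
  have G: "map_poly base_emb (eval_t d G) = mult_poly m"
  proof (rule poly_eqI)
    fix n
    have "coeff (map_poly base_emb (eval_t d G)) n = ev c (pcompose (coeff D n) t_poly)"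
      by (simp add: G_def coeff_map_poly coeff_eval_t_swap_poly t_poly_def emb)
    also have "\<dots> = coeff (mult_poly m) n"
      by (simp add: D[symmetric] coeff_map_poly t_def)
    finally show "coeff (map_poly base_emb (eval_t d G)) n = coeff (mult_poly m) n" .
  qed
  have roots: "(\<Prod>\<alpha>\<in>#proots (map_poly base_emb (dynatomic d m)). [:- multiplier d m \<alpha>, 1:]) = mult_poly m ^ m"
    using m by (simp add: dynatomic_eq_Phi map_poly_Phi proots_period_poly mult_poly_power
        multiplier_def iter_poly_def emb flip: prod_unfold_prod_mset)
  have inj: "map_poly base_emb p = map_poly base_emb q \<longleftrightarrow> p = q" for p q
    unfolding emb by (rule map_poly_ev_eq_iff[OF c])
  have lead: "lead_coeff (eval_t d G) = 1"
  proof -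
    have "degree (map_poly base_emb (eval_t d G)) = degree (eval_t d G)"
      by (rule degree_map_poly) (simp add: base_emb_def)
    then have "base_emb (lead_coeff (eval_t d G)) = lead_coeff (mult_poly m)"
      by (simp flip: G add: coeff_map_poly base_emb_def)
    also have "\<dots> = base_emb 1"
      by (simp add: mult_poly_def monic_prod_linear base_emb_def)
    finally show ?thesis by (simp add: base_emb_def) (metis to_fract_1 to_fract_eq_iff)
  qed
  have "multiplier_poly d m = eval_t d G"
    unfolding multiplier_poly_def roots
  proof (rule the_equality)
    show "lead_coeff (eval_t d G) = 1 \<and> map_poly base_emb (eval_t d G) ^ m = mult_poly m ^ m"
      by (simp only: lead G)
  next
    fix \<delta> assume \<delta>: "lead_coeff \<delta> = 1 \<and> map_poly base_emb \<delta> ^ m = mult_poly m ^ m"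
    then have "map_poly base_emb (\<delta> ^ m) = map_poly base_emb (eval_t d G ^ m)"
      unfolding G[symmetric] by (simp add: map_poly_ev_power emb)
    then have "\<delta> ^ m = eval_t d G ^ m" unfolding inj .
    then show "\<delta> = eval_t d G"
      by (rule monic_power_eq_imp_eq[OF conjunct1[OF \<delta>] lead m])
  qed
  moreover have "lead_coeff ((-1) ^ nat (dyn_degree d m div int m) * G) = 1"
  proof -
    have "nat (dyn_degree d m div int m) = card (Cyc m)"
      using m by (simp add: dyn_degree_eq)
    moreover have "(- 1) ^ k * (- 1) ^ k = (1 :: int poly)" for k
      by (simp flip: power_mult_distrib)
    ultimately show ?thesis
      by (simp only: lead_coeff_mult lead_coeff_power lead_coeff_minus lead_coeff_1 G_def
          lead_coeff_swap_mult_poly[OF m D])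
  qed
  ultimately show ?thesis by blast
qed

end
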